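(* Let $\boldsymbol{\mu}=(\mu_1,\dots,\mu_N)\in(\mathbb{T}\setminus\{1\})^N$ and let $L_1,\dots,L_T$ be linear forms in $X_1,\dots,X_N$ with positive coefficients. Assume that for each $n$ there exists $t$ such that $L_t$ really depends on $X_n$. Set $Z(\boldsymbol{\mu};\cdot)=Z(1;L_1,\dots,L_T;\boldsymbol{\mu};\cdot)$. Let $\mathbf{a}\in\mathbb{N}^N$, and set $$E(\mathbf{a})=\{\mathbf{m}\in(\mathbb{N}^* )^N:\ \mathbf{m}\ngeq\mathbf{a}+\mathbf{1}\}=\{\mathbf{m}\in(\mathbb{N}^* )^N:\ \exists n\in\{1,\dots,N\},\ m_n\le a_n\}.$$ For all $t\in\{1,\dots,T\}$ set $\delta_t=L_t(\mathbf{X}+\mathbf{a})-L_t(\mathbf{X})$; then $\delta_t\in\mathbb{R}$. Put $\boldsymbol{\delta}=(\delta_1,\dots,\delta_T)$. Then for all $\mathbf{k}\in\mathbb{N}^T$ the following relation holds: $$(1-\boldsymbol{\mu}^{\mathbf{a}})\,Z(\boldsymbol{\mu};-\mathbf{k})=\boldsymbol{\mu}^{\mathbf{a}}\sum_{\mathbf{0}\le\mathbf{u}<\mathbf{k}}\boldsymbol{\delta}^{\mathbf{k}-\mathbf{u}}\binom{\mathbf{k}}{\mathbf{u}}\,Z(\boldsymbol{\mu};-\mathbf{u})+Z_{N-1}^{\mathbf{a}}(-\mathbf{k}),$$ where $$Z_{N-1}^{\mathbf{a}}(\mathbf{s})=\sum_{\mathbf{m}\in E(\mathbf{a})}\boldsymbol{\mu}^{\mathbf{m}}\prod_{t=1}^T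 L_t(\mathbf{m})^{-s_t}.$$ Moreover $$Z_{N-1}^{\mathbf{a}}(\mathbf{s})=\sum_{q=1}^{N-1}\ \sum_{\substack{I\subset\{1,\dots,N\}\\ \#I=q}}\ \sum_{\mathbf{b}=(b_i)\in\prod_{i\in I^c}\{0,\dots,a_i\}}\Big(\prod_{i\in I^c}\mu_i^{b_i}\Big)\,Z\big(1;L_1^{\mathbf{a},I,\mathbf{b}},\dots,L_T^{\mathbf{a},I,\mathbf{b}};(\mu_i)_{i\in I};\mathbf{s}\big).$$ In particular, $Z_{N-1}^{\mathbf{a}}$ is a finite linear combination of zeta series $Z$ associated to linear forms of at most $N-1$ variables.
   Context: Here $N,T\ge1$ are integers. Notation: $\mathbb{N}=\{0,1,2,\dots\}$, $\mathbb{N}^*=\mathbb{N}\setminus\{0\}$, $\mathbb{T}=\{z\in\mathbb{C}:|z|=1\}$ (not to be confused with the integer $T$), $\mathbf{0}=(0,\dots,0)$, $\mathbf{1}=(1,\dots,1)$, $\mathbf{z}^{\mathbf{m}}=\prod_n z_n^{m_n}$. Zeta series: for real polynomials $Q,P_1,\dots,P_T$ in $N$ variables and $\mathbf{s}=(s_1,\dots,s_T)\in\mathbb{C}^T$, $$Z(Q;P_1,\dots,P_T;\boldsymbol{\mu};\mathbf{s})=\sum_{\mathbf{m}\in(\mathbb{N}^* )^N}\boldsymbol{\mu}^{\mathbf{m}}\,Q(\mathbf{m})\prod_{t=1}^T P_t(\mathbf{m})^{-s_t}.$$ For $Q=1$ and $P_t=L_t$ as in the claim it converges absolutely when $\Re(s_1),\dots,\Re(s_T)$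 are sufficiently large and extends holomorphically to $\mathbb{C}^T$. The same notation is used for holomorphic continuations, and likewise for $Z_{N-1}^{\mathbf{a}}$; values at negative integers are those of the continuations. Multi-indices: $\mathbf{0}\le\mathbf{u}<\mathbf{k}$ means $\mathbf{u}\in\mathbb{N}^T$, $u_t\le k_t$ for all $t$ and $\mathbf{u}\ne\mathbf{k}$; $\binom{\mathbf{k}}{\mathbf{u}}=\prod_{t=1}^T\binom{k_t}{u_t}$. Restricted functions: let $I=\{i_1,\dots,i_q\}\subset\{1,\dots,N\}$ with $q=\#I$, $I^c=\{1,\dots,N\}\setminus I=\{j_1,\dots,j_{N-q}\}$ and $\mathbf{b}=(b_i)_{i\in I^c}\in\prod_{i\in I^c}\{0,\dots,a_i\}$. For $f:\mathbb{N}^N\to\mathbb{C}$, the function $f^{\mathbf{a},I,\mathbf{b}}:\mathbb{N}^q\to\mathbb{C}$ is $f^{\mathbf{a},I,\mathbf{b}}(d_1,\dots,d_q)=f(m_1,\dots,m_N)$ with $m_{i_k}=a_{i_k}+d_k$ for $k=1,\dots,q$ and $m_{j_k}=b_{j_k}$ for $k=1,\dots,N-q$.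
   Formalization: The printed "Moreover" formula is false (N=T=1, L_1=X_1, a=1: right side is empty, left side is μ). Corrected: b_i ranges over {1,…,a_i}, a factor ∏_{i∈I} μ_i^{a_i} is added, and q starts at 0 (I empty: zeta series in zero variables). *)

theory Defs
  imports "HOL-Analysis.Analysis"
begin

text \<open>Variables are labelled by a finite type \<open>'n\<close> and linear forms by a finite type \<open>'t\<close>, so
  that \<open>N = CARD('n)\<close> and \<open>T = CARD('t)\<close>. A series in fewer variables keeps the labels it uses:
  its variables are labelled by a set \<open>V :: 'n set\<close> and its summation points are the extensional
  functions on \<open>V\<close> with positive values.\<close>

definition real_vec :: "('n::finite \<Rightarrow> nat) \<Rightarrow> real ^ 'n" where
  "real_vec m = (\<chi> n. real (m n))"

definition neg_nat_vec :: "('t::finite \<Rightarrow> nat) \<Rightarrow> complex ^ 't" where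
  "neg_nat_vec k = (\<chi> t. - of_nat (k t))"

text \<open>Holomorphy on all of \<open>\<complex>\<^sup>T\<close>: at every point the Frechet derivative exists and is
  complex linear.\<close>

definition entire :: "(complex ^ 't::finite \<Rightarrow> complex) \<Rightarrow> bool" where
  "entire F \<longleftrightarrow>
     (\<forall>s. \<exists>D. (F has_derivative D) (at s) \<and> (\<forall>c v. D (c *s v) = c * D v))"

text \<open>\<open>has_sum\<close> is unconditional summation, which for complex terms is absolute convergence.\<close>

definition is_continuation ::
    "(complex ^ 't::finite \<Rightarrow> 'i \<Rightarrow> complex) \<Rightarrow> 'i set \<Rightarrow> (complex ^ 't \<Rightarrow> complex) \<Rightarrow> bool" where
  "is_continuation f A F \<longleftrightarrow>
     entire F \<and> (\<exists>R. \<forall>s. (\<forall>t. Re (s $ t) > R) \<longrightarrow> (f s has_sum F s) A)"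

definition continuation ::
    "(complex ^ 't::finite \<Rightarrow> 'i \<Rightarrow> complex) \<Rightarrow> 'i set \<Rightarrow> complex ^ 't \<Rightarrow> complex" where
  "continuation f A = (THE F. is_continuation f A F)"

definition zeta_term ::
    "'n set \<Rightarrow> (('n::finite \<Rightarrow> nat) \<Rightarrow> real) \<Rightarrow> ('t::finite \<Rightarrow> ('n \<Rightarrow> nat) \<Rightarrow> real) \<Rightarrow>
     ('n \<Rightarrow> complex) \<Rightarrow> complex ^ 't \<Rightarrow> ('n \<Rightarrow> nat) \<Rightarrow> complex" where
  "zeta_term V Q P \<mu> s m =
     (\<Prod>n\<in>V. \<mu> n ^ m n) * of_real (Q m) * (\<Prod>t\<in>UNIV. of_real (P t m) powr (- (s $ t)))"

text \<open>\<open>zeta V Q P \<mu> s\<close> is \<open>Z(Q; P\<^sub>1, \<dots>, P\<^sub>T; (\<mu>\<^sub>i)\<^bsub>i\<in>V\<^esub>; s)\<close>, continued to \<open>\<complex>\<^sup>T\<close>. For \<open>V = {}\<close> the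
  series has one term, the one at the empty tuple.\<close>

definition zeta ::
    "'n set \<Rightarrow> (('n::finite \<Rightarrow> nat) \<Rightarrow> real) \<Rightarrow> ('t::finite \<Rightarrow> ('n \<Rightarrow> nat) \<Rightarrow> real) \<Rightarrow>
     ('n \<Rightarrow> complex) \<Rightarrow> complex ^ 't \<Rightarrow> complex" where
  "zeta V Q P \<mu> = continuation (zeta_term V Q P \<mu>) (V \<rightarrow>\<^sub>E {1..})"

definition boundary_set :: "('n \<Rightarrow> nat) \<Rightarrow> ('n \<Rightarrow> nat) set" where
  "boundary_set a = {m. (\<forall>n. m n \<ge> 1) \<and> (\<exists>n. m n \<le> a n)}"

definition boundary_zeta ::
    "('n \<Rightarrow> nat) \<Rightarrow> ('t::finite \<Rightarrow> ('n::finite \<Rightarrow> nat) \<Rightarrow> real) \<Rightarrow>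
     ('n \<Rightarrow> complex) \<Rightarrow> complex ^ 't \<Rightarrow> complex" where
  "boundary_zeta a P \<mu> = continuation (zeta_term UNIV (\<lambda>_. 1) P \<mu>) (boundary_set a)"

definition restrict_fun ::
    "('n \<Rightarrow> nat) \<Rightarrow> 'n set \<Rightarrow> ('n \<Rightarrow> nat) \<Rightarrow> (('n \<Rightarrow> nat) \<Rightarrow> 'b) \<Rightarrow> ('n \<Rightarrow> nat) \<Rightarrow> 'b" where
  "restrict_fun a I b f d = f (\<lambda>i. if i \<in> I then a i + d i else b i)"

text \<open>The forms restricted to fewer variables may have a constant term.\<close>

definition nonneg_affine_form :: "'n set \<Rightarrow> (('n::finite \<Rightarrow> nat) \<Rightarrow> real) \<Rightarrow> bool" where
  "nonneg_affine_form V P \<longleftrightarrow>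
     (\<exists>e0 e. e0 \<ge> 0 \<and> (\<forall>i\<in>V. e i \<ge> 0) \<and> (\<forall>d. P d = e0 + (\<Sum>i\<in>V. e i * real (d i))))"

end

theory Submission
  imports Defs "HOL-Complex_Analysis.Conformal_Mappings"
begin

text \<open>Extend a summand \<open>f\<close> by zero to points with a nonpositive coordinate. Then taking \<open>K\<close> backward
  differences in every variable multiplies \<open>\<Sum> \<mu>\<^sup>m f(m)\<close> by \<open>\<Prod>(1 - \<mu>\<^sub>n)\<^sup>K\<close>, without boundary terms. For
  \<open>f(m) = \<Prod> P\<^sub>t(m)\<^bsup>-s\<^sub>t\<^esup>\<close>, which is holomorphic in \<open>m\<close> on a product of half planes, Cauchy's estimates on
  discs of radius comparable to \<open>m\<^sub>n\<close> show that each difference gains a factor \<open>1/m\<^sub>n\<close>. Hence the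
  differenced series converges absolutely for large \<open>K\<close>, locally uniformly in \<open>s\<close>, and gives the
  continuation. Its value at \<open>s\<close> is a regularised sum that depends linearly on \<open>f\<close>, so at \<open>-k\<close> the
  multinomial expansion of \<open>\<Prod>(L\<^sub>t + \<delta>\<^sub>t)\<^bsup>k\<^sub>t\<^esup>\<close> may be summed term by term. Splitting the points with positive
  coordinates according to which coordinates exceed those of \<open>a\<close> yields the decomposition of the
  boundary series, and the part where all coordinates do is \<open>\<mu>\<^sup>a\<close> times the series of the shifted
  forms \<open>L\<^sub>t + \<delta>\<^sub>t\<close>.\<close>

section \<open>Entire functions of several variables\<close>

lemma has_sum_diff:
  fixes f g :: "'a \<Rightarrow> 'b::real_normed_vector"
  assumes "(f has_sum a) A" "(g has_sum b) A"
  shows "((\<lambda>x. f x - g x) has_sum (a - b)) A"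
  using has_sum_add[OF assms(1), of "\<lambda>x. - g x" "- b"] assms(2) by (simp add: has_sum_uminus)

section \<open>Restriction to complex lines and uniqueness of continuations\<close>

lemma norm_cvec_scale: "norm (c *s v) = norm c * norm v" for v :: "complex ^ 'n::finite"
  unfolding norm_vec_def L2_set_def
  by (simp add: norm_mult power_mult_distrib sum_distrib_left[symmetric] real_sqrt_mult)

lemma bounded_linear_cvec_scale: "bounded_linear (\<lambda>z. z *s v)" for v :: "complex ^ 'n::finite"
proof (rule bounded_linear_intro[where K = "norm v"])
  fix x y :: complex and r :: real
  show "(x + y) *s v = x *s v + y *s v" by (simp add: vec_eq_iff distrib_right)
  show "(r *\<^sub>R x) *s v = r *\<^sub>R (x *s v)" by (simp add: vec_eq_iff)
  show "norm (x *s v) \<le> norm x * norm v" by (simp add: norm_cvec_scale)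
qed

text \<open>This is the bridge to one-variable theory: complex linearity of \<open>D\<close> turns
  the Frechet derivative along a complex line into a complex derivative with value
  \<open>D v\<close>.\<close>

lemma entire_has_field_derivative_line:
  fixes F :: "complex ^ 't::finite \<Rightarrow> complex"
  assumes D: "(F has_derivative D) (at (s + z *s v))" and lin: "\<And>c v. D (c *s v) = c * D v"
  shows "((\<lambda>z. F (s + z *s v)) has_field_derivative D v) (at z)"
proof -
  have "((\<lambda>z. s + z *s v) has_derivative (\<lambda>h. 0 + h *s v)) (at z)"
    by (intro has_derivative_add has_derivative_const
        bounded_linear_imp_has_derivative bounded_linear_cvec_scale)
  then have "((\<lambda>z. s + z *s v) has_derivative (\<lambda>h. h *s v)) (at z)" by simp
  from diff_chain_at[OF this D] show ?thesis
    by (simp add: has_field_derivative_def o_def lin mult.commute[of _ "D v"] )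
qed

lemma entire_holomorphic_line:
  assumes "entire F" shows "(\<lambda>z. F (s + z *s v)) holomorphic_on A"
proof -
  have "\<exists>d. ((\<lambda>z. F (s + z *s v)) has_field_derivative d) (at z)" for z
    using assms entire_has_field_derivative_line unfolding entire_def by blast
  then show ?thesis
    unfolding holomorphic_on_def by (meson field_differentiable_at_within field_differentiable_def)
qed

text \<open>On the line through \<open>s\<close> in direction (1, ..., 1) every coordinate has real
  part above \<open>R\<close> once \<open>Re z\<close> is large. The one-variable identity theorem
  carries the equality from that half plane to \<open>z = 0\<close>.\<close>

lemma entire_eqI:
  fixes F G :: "complex ^ 'a::finite \<Rightarrow> complex"
  assumes F: "entire F" and G: "entire G"
    and eq: "\<And>s. (\<forall>t. Re (s $ t) > R) \<Longrightarrow> F s = G s"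
  shows "F = G"
proof
  fix s :: "complex ^ 'a"
  obtain C where C: "\<And>t. - Re (s $ t) \<le> C"
  proof -
    have "- Re (s $ t) \<le> Max (range (\<lambda>t. - Re (s $ t)))" for t by simp
    then show ?thesis using that by blast
  qed
  have "F (s + 0 *s 1) = G (s + 0 *s 1)"
  proof (rule analytic_continuation_open[of "{z. Re z > R + C}" UNIV
        "\<lambda>z. F (s + z *s 1)" "\<lambda>z. G (s + z *s 1)" 0])
    have "of_real (R + C + 1) \<in> {z. Re z > R + C}" by simp
    then show "{z. Re z > R + C} \<noteq> {}" by blast
    show "F (s + z *s 1) = G (s + z *s 1)" if "z \<in> {z. Re z > R + C}" for z
    proof (rule eq, rule allI)
      fix t show "Re ((s + z *s 1) $ t) > R" using that C[of t] by simp
    qed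
  qed (auto intro: entire_holomorphic_line F G open_halfspace_Re_gt)
  then show "F s = G s" by simp
qed

text \<open>Two continuations agree where both half spaces of convergence overlap. This justifies
  the definite description in \<open>continuation\<close>.\<close>

lemma is_continuation_unique:
  assumes F: "is_continuation f A F" and G: "is_continuation f A G"
  shows "F = G"
proof -
  obtain R1 where R1: "\<And>s. (\<forall>t. Re (s $ t) > R1) \<Longrightarrow> (f s has_sum F s) A"
    using F unfolding is_continuation_def by blast
  obtain R2 where R2: "\<And>s. (\<forall>t. Re (s $ t) > R2) \<Longrightarrow> (f s has_sum G s) A"
    using G unfolding is_continuation_def by blast
  show ?thesis
  proof (rule entire_eqI[where R = "max R1 R2"])
    fix s :: "complex ^ 'a" assume "\<forall>t. Re (s $ t) > max R1 R2"
    then show "F s = G s" using has_sum_unique[OF R1 R2] by simp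
  qed (use F G in \<open>auto simp: is_continuation_def\<close>)
qed

lemma continuation_eqI: "is_continuation f A F \<Longrightarrow> continuation f A = F"
  unfolding continuation_def by (blast intro: is_continuation_unique the_equality)

section \<open>Closure properties of entire functions\<close>

lemma entire_const: "entire (\<lambda>_. c)"
  unfolding entire_def by (auto intro!: exI[of _ "\<lambda>_. 0"])

lemma entire_add:
  assumes "entire F" "entire G" shows "entire (\<lambda>s. F s + G s)"
  unfolding entire_def
proof
  fix s
  obtain D E where "(F has_derivative D) (at s)" "\<And>c v. D (c *s v) = c * D v"
     "(G has_derivative E) (at s)" "\<And>c v. E (c *s v) = c * E v"
    using assms unfolding entire_def by meson
  then show "\<exists>D. ((\<lambda>s. F s + G s) has_derivative D) (at s) \<and> (\<forall>c v. D (c *s v) = c * D v)"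
    by (intro exI[of _ "\<lambda>v. D v + E v"]) (auto intro: has_derivative_add simp: distrib_left)
qed

lemma entire_mult:
  assumes "entire F" "entire G" shows "entire (\<lambda>s. F s * G s)"
  unfolding entire_def
proof
  fix s
  obtain D E where "(F has_derivative D) (at s)" "\<And>c v. D (c *s v) = c * D v"
     "(G has_derivative E) (at s)" "\<And>c v. E (c *s v) = c * E v"
    using assms unfolding entire_def by meson
  then show "\<exists>D. ((\<lambda>s. F s * G s) has_derivative D) (at s) \<and> (\<forall>c v. D (c *s v) = c * D v)"
    by (intro exI[of _ "\<lambda>v. F s * E v + D v * G s"])
      (auto intro!: has_derivative_mult simp: distrib_left mult.assoc mult.left_commute distrib_right)
qed

lemma entire_diff: "entire F \<Longrightarrow> entire G \<Longrightarrow> entire (\<lambda>s. F s - G s)"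
  using entire_add[OF _ entire_mult[OF entire_const[of "-1"]], of F G] by simp

lemma entire_sum: "(\<And>i. i \<in> I \<Longrightarrow> entire (F i)) \<Longrightarrow> entire (\<lambda>s. \<Sum>i\<in>I. F i s)"
  by (induction I rule: infinite_finite_induct) (auto intro: entire_const entire_add)

lemma entire_prod: "(\<And>i. i \<in> I \<Longrightarrow> entire (F i)) \<Longrightarrow> entire (\<lambda>s. \<Prod>i\<in>I. F i s)"
  by (induction I rule: infinite_finite_induct) (auto intro: entire_const entire_mult)

text \<open>For \<open>w = 0\<close> the function is constantly 0 by the convention for
  \<open>powr\<close>; otherwise it is an exponential in one coordinate of \<open>s\<close>.\<close>

lemma entire_powr: "entire (\<lambda>s. w powr (- (s $ t)))"
proof (cases "w = 0")
  case False
  show ?thesis unfolding entire_def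
  proof
    fix s :: "complex ^ 'a"
    define d where "d = - (w powr (- (s $ t)) * Ln w)"
    have "((\<lambda>z. w powr (- z)) has_field_derivative d) (at (s $ t))"
      using False unfolding powr_def d_def by (auto intro!: derivative_eq_intros)
    from diff_chain_at[OF bounded_linear_imp_has_derivative[OF bounded_linear_vec_nth]
        this[unfolded has_field_derivative_def]]
    have "((\<lambda>s. w powr (- (s $ t))) has_derivative (\<lambda>v. d * v $ t)) (at s)"
      by (simp add: o_def)
    then show "\<exists>D. ((\<lambda>s. w powr (- (s $ t))) has_derivative D) (at s) \<and>
        (\<forall>c v. D (c *s v) = c * D v)"
      by (intro exI conjI) auto
  qed
qed (simp add: entire_const)

section \<open>Infinite sums of entire functions\<close>

text \<open>Cauchy's inequality on the line in direction \<open>h\<close> yields a derivative bound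
  and a first-order Taylor bound. Both depend on \<open>F\<close> only through \<open>B\<close>, so
  they can be summed over a family of functions.\<close>

lemma entire_local_cauchy:
  assumes F: "entire F" and D: "(F has_derivative D) (at s)" "\<And>c v. D (c *s v) = c * D v"
    and r: "r > 0" and bnd: "\<And>x. x \<in> ball s r \<Longrightarrow> norm (F x) \<le> B"
  shows "norm (D h) \<le> 2 * B / r * norm h"
    and "norm h < r / 2 \<Longrightarrow> norm (F (s + h) - F s - D h) \<le> 8 * B / r^2 * norm h ^ 2"
proof -
  define \<phi> where "\<phi> = (\<lambda>z. F (s + z *s h))"
  have hol: "\<phi> holomorphic_on X" for X unfolding \<phi>_def by (rule entire_holomorphic_line[OF F])
  have d: "deriv \<phi> 0 = D h" unfolding \<phi>_def
    by (rule DERIV_imp_deriv, rule entire_has_field_derivative_line) (use D in auto)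
  \<comment> \<open>The radius is chosen so that the closed disc about \<open>w\<close> is sent into
    \<open>ball s r\<close> by \<open>z \<mapsto> s + z *s h\<close>: both
    \<open>norm w * norm h\<close> and the radius times \<open>norm h\<close> are at most
    \<open>r / 2\<close>.\<close>
  have der: "norm ((deriv ^^ n) \<phi> w) \<le> fact n * B / (r / (2 * norm h)) ^ n"
    if "h \<noteq> 0" "norm w * norm h < r / 2" for n w
  proof (rule Cauchy_inequality)
    show "0 < r / (2 * norm h)" using r that by simp
    fix x assume x: "norm (w - x) = r / (2 * norm h)"
    have "norm x \<le> norm w + r / (2 * norm h)"
      using x norm_triangle_ineq4[of w "w - x"] by simp
    then have "norm x * norm h \<le> (norm w + r / (2 * norm h)) * norm h"
      by (intro mult_right_mono) auto
    also have "\<dots> < r" using that by (simp add: field_simps)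
    finally show "norm (\<phi> x) \<le> B" unfolding \<phi>_def
      by (intro bnd) (simp add: dist_norm norm_cvec_scale)
  qed (use hol holomorphic_on_imp_continuous_on in auto)
  show "norm (D h) \<le> 2 * B / r * norm h"
  proof (cases "h = 0")
    case True
    then show ?thesis using D(2)[of 0 0] by simp
  next
    case False
    then show ?thesis using der[of 0 1] d r by (simp add: field_simps)
  qed
  show "norm (F (s + h) - F s - D h) \<le> 8 * B / r^2 * norm h ^ 2" if h: "norm h < r / 2"
  proof (cases "h = 0")
    case True
    then show ?thesis using D(2)[of 0 0] by simp
  next
    case False
    \<comment> \<open>Taylor expansion of \<open>\<phi>\<close> from 0 to 1, where
      \<open>\<phi> 0 = F s\<close>, \<open>\<phi> 1 = F (s + h)\<close> and the linear term is
      \<open>D h\<close>.\<close>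
    have "norm ((deriv ^^ 0) \<phi> 1 - (\<Sum>i\<le>1. (deriv ^^ i) \<phi> 0 * (1 - 0) ^ i / fact i))
        \<le> (8 * B / r^2 * norm h ^ 2) * norm (1 - 0 :: complex) ^ Suc 1 / fact 1"
    proof (rule complex_Taylor[where S = "cball 0 1"])
      fix i x
      have "((deriv ^^ i) \<phi> has_field_derivative deriv ((deriv ^^ i) \<phi>) x) (at x)"
        by (rule holomorphic_derivI[of _ UNIV]) (auto intro: holomorphic_higher_deriv hol)
      then show "((deriv ^^ i) \<phi> has_field_derivative (deriv ^^ Suc i) \<phi> x) (at x within cball 0 1)"
        by (auto intro: has_field_derivative_at_within)
    next
      fix x :: complex assume "x \<in> cball 0 1"
      then have "norm x * norm h \<le> 1 * norm h" by (intro mult_right_mono) auto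
      then have "norm ((deriv ^^ 2) \<phi> x) \<le> fact 2 * B / (r / (2 * norm h)) ^ 2"
        using h by (intro der[OF False]) auto
      also have "\<dots> = 8 * B / r^2 * norm h ^ 2"
        using r False by (simp add: field_simps power2_eq_square)
      finally show "norm ((deriv ^^ Suc 1) \<phi> x) \<le> 8 * B / r^2 * norm h ^ 2"
        by (simp add: numeral_2_eq_2)
    qed auto
    then show ?thesis by (simp add: d) (simp add: \<phi>_def algebra_simps)
  qed
qed

text \<open>The derivative is the sum of the termwise derivatives: the Taylor remainder of each term
  is at most a multiple of \<open>B i\<close> times the squared increment, so the summed remainder
  is still quadratic.\<close>

lemma infsum_entire_has_derivative:
  fixes G :: "'i \<Rightarrow> complex ^ 't::finite \<Rightarrow> complex"
  assumes G: "\<And>i. i \<in> A \<Longrightarrow> entire (G i)" and r: "r > 0"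
    and bnd: "\<And>i x. i \<in> A \<Longrightarrow> x \<in> ball s r \<Longrightarrow> norm (G i x) \<le> B i"
    and B: "B summable_on A"
  shows "\<exists>D. ((\<lambda>x. \<Sum>\<^sub>\<infinity>i\<in>A. G i x) has_derivative D) (at s) \<and> (\<forall>c v. D (c *s v) = c * D v)"
proof -
  have "\<forall>i\<in>A. \<exists>D. (G i has_derivative D) (at s) \<and> (\<forall>c v. D (c *s v) = c * D v)"
    using G unfolding entire_def by blast
  then obtain D where D: "\<And>i. i \<in> A \<Longrightarrow> (G i has_derivative D i) (at s)"
    and lin: "\<And>i c v. i \<in> A \<Longrightarrow> D i (c *s v) = c * D i v" by metis
  have Dlin: "linear (D i)" if "i \<in> A" for i using D[OF that] has_derivative_linear by blast
  have Dle: "norm (D i h) \<le> B i * (2 / r * norm h)" if "i \<in> A" for i h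
    using entire_local_cauchy(1)[OF G D lin r bnd, OF that that that that, of h] by (simp add: mult_ac)
  have sumG: "(\<lambda>i. G i x) summable_on A" if "x \<in> ball s r" for x
    by (rule abs_summable_summable, rule Infinite_Sum.abs_summable_on_comparison_test'[OF B]) (use bnd that in auto)
  have sumD: "(\<lambda>i. D i h) summable_on A" for h
    by (rule abs_summable_summable,
        rule Infinite_Sum.abs_summable_on_comparison_test'[OF summable_on_cmult_left[OF B]])
      (rule Dle)
  define E where "E h = (\<Sum>\<^sub>\<infinity>i\<in>A. D i h)" for h
  have E: "((\<lambda>i. D i h) has_sum E h) A" for h unfolding E_def using sumD by simp
  have Escale: "E (c *s v) = c * E v" for c v
    unfolding E_def by (subst infsum_cmult_right'[symmetric]) (auto intro: infsum_cong simp: lin)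
  have "linear E"
  proof (rule linearI)
    show "E (x + y) = E x + E y" for x y
      using has_sum_unique[OF E[of "x + y"]] has_sum_add[OF E[of x] E[of y]] Dlin
      by (subst has_sum_unique[OF E[of "x + y"], of "E x + E y"])
        (auto simp: linear_add cong: has_sum_cong)
    show "E (c *\<^sub>R x) = c *\<^sub>R E x" for c x
    proof -
      have "c *\<^sub>R x = of_real c *s x" by (simp add: vec_eq_iff scaleR_conv_of_real[where 'a = complex])
      then show ?thesis by (simp add: Escale scaleR_conv_of_real)
    qed
  qed
  then have blE: "bounded_linear E" by (rule linear_conv_bounded_linear[THEN iffD1])
  define S where "S = infsum B A"
  have S: "(B has_sum S) A" unfolding S_def using B by simp
  have "((\<lambda>x. \<Sum>\<^sub>\<infinity>i\<in>A. G i x) has_derivative E) (at s)"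
  proof (rule has_derivativeI_sandwich[OF _ blE])
    show "r / 2 > 0" using r by simp
    fix y assume y: "y \<noteq> s" "dist y s < r / 2"
    have ny: "norm (y - s) < r / 2" using y by (simp add: dist_norm)
    have yb: "y \<in> ball s r" "s \<in> ball s r" using y r by (auto simp: dist_commute)
    have "((\<lambda>i. G i y - G i s - D i (y - s)) has_sum
        (\<Sum>\<^sub>\<infinity>i\<in>A. G i y) - (\<Sum>\<^sub>\<infinity>i\<in>A. G i s) - E (y - s)) A"
      using sumG[OF yb(1)] sumG[OF yb(2)] E by (intro has_sum_diff has_sum_infsum)
    moreover have "((\<lambda>i. B i * (8 / r^2 * norm (y - s)^2)) has_sum S * (8 / r^2 * norm (y - s)^2)) A"
      by (intro has_sum_cmult_left S)
    moreover have "norm (G i y - G i s - D i (y - s)) \<le> B i * (8 / r^2 * norm (y - s)^2)"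
      if "i \<in> A" for i
      using entire_local_cauchy(2)[OF G D lin r bnd ny, OF that that that that] by (simp add: mult_ac)
    ultimately have "norm ((\<Sum>\<^sub>\<infinity>i\<in>A. G i y) - (\<Sum>\<^sub>\<infinity>i\<in>A. G i s) - E (y - s))
        \<le> S * (8 / r^2 * norm (y - s)^2)" by (rule norm_infsum_le)
    then show "norm ((\<Sum>\<^sub>\<infinity>i\<in>A. G i y) - (\<Sum>\<^sub>\<infinity>i\<in>A. G i s) - E (y - s)) / norm (y - s)
        \<le> S * (8 / r^2) * norm (y - s)"
      using y by (simp add: field_simps power2_eq_square)
  next
    have "((\<lambda>y. S * (8 / r^2) * norm (y - s)) \<longlongrightarrow> S * (8 / r^2) * norm (s - s)) (at s)"
      by (intro tendsto_intros)
    then show "((\<lambda>y. S * (8 / r^2) * norm (y - s)) \<longlongrightarrow> 0) (at s)" by simp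
  qed
  then show ?thesis using Escale by blast
qed

lemma entire_sum_const_mult:
  "(\<And>i. i \<in> I \<Longrightarrow> entire (F i)) \<Longrightarrow> entire (\<lambda>s. \<Sum>i\<in>I. c i * F i s)"
  by (intro entire_sum entire_mult entire_const)

text \<open>This serves to cut the set of summation points into finitely many disjoint pieces, each
  parametrised by its own \<open>h i\<close>; beyond the largest abscissa all pieces converge
  together.\<close>

lemma is_continuation_sum:
  fixes f :: "'k \<Rightarrow> complex ^ 't::finite \<Rightarrow> 'i \<Rightarrow> complex"
  assumes I: "finite I" and F: "\<And>i. i \<in> I \<Longrightarrow> is_continuation (f i) (A i) (F i)"
    and disj: "\<And>i j. i \<in> I \<Longrightarrow> j \<in> I \<Longrightarrow> i \<noteq> j \<Longrightarrow> h i ` A i \<inter> h j ` A j = {}"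
    and inj: "\<And>i. i \<in> I \<Longrightarrow> inj_on (h i) (A i)"
    and g: "\<And>i s d. i \<in> I \<Longrightarrow> d \<in> A i \<Longrightarrow> g s (h i d) = c i * f i s d"
    and B: "B = (\<Union>i\<in>I. h i ` A i)"
  shows "is_continuation g B (\<lambda>s. \<Sum>i\<in>I. c i * F i s)"
proof -
  have "\<forall>i\<in>I. \<exists>R. \<forall>s. (\<forall>t. Re (s $ t) > R) \<longrightarrow> (f i s has_sum F i s) (A i)"
    using F unfolding is_continuation_def by blast
  then obtain R where R: "\<And>i s. i \<in> I \<Longrightarrow> \<forall>t. Re (s $ t) > R i \<Longrightarrow> (f i s has_sum F i s) (A i)"
    by metis
  show ?thesis unfolding is_continuation_def
  \<comment> \<open>Inserting 0 keeps the maximum meaningful when \<open>I\<close> is empty.\<close>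
  proof (intro conjI exI[of _ "Max (insert 0 (R ` I))"] allI impI)
    show "entire (\<lambda>s. \<Sum>i\<in>I. c i * F i s)"
      using F unfolding is_continuation_def by (intro entire_sum_const_mult) blast
    fix s :: "complex ^ 't" assume s: "\<forall>t. Max (insert 0 (R ` I)) < Re (s $ t)"
    show "(g s has_sum (\<Sum>i\<in>I. c i * F i s)) B" unfolding B
    proof (rule sum_has_sum[OF I _ disj])
      fix i assume i: "i \<in> I"
      have "R i \<le> Max (insert 0 (R ` I))" using I i by simp
      then have "(f i s has_sum F i s) (A i)" using s by (intro R[OF i]) (blast intro: le_less_trans)
      then have "((\<lambda>d. c i * f i s d) has_sum c i * F i s) (A i)" by (rule has_sum_cmult_right)
      also have "?this \<longleftrightarrow> ((g s \<circ> h i) has_sum c i * F i s) (A i)"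
        by (rule has_sum_cong) (simp add: g[OF i])
      finally show "(g s has_sum c i * F i s) (h i ` A i)"
        by (simp only: has_sum_reindex[OF inj[OF i]])
    qed
  qed
qed

section \<open>Backward differences and regularised sums\<close>

text \<open>The test \<open>1 < m n\<close> implements the extension by zero: from a point with
  positive coordinates, \<open>f\<close> is never evaluated at a point with a zero
  coordinate.\<close>

definition bdiff :: "'n \<Rightarrow> (('n \<Rightarrow> nat) \<Rightarrow> complex) \<Rightarrow> ('n \<Rightarrow> nat) \<Rightarrow> complex" where
  "bdiff n f m = f m - (if 1 < m n then f (m(n := m n - 1)) else 0)"

definition bdiffs :: "nat \<Rightarrow> 'n list \<Rightarrow> (('n \<Rightarrow> nat) \<Rightarrow> complex) \<Rightarrow> ('n \<Rightarrow> nat) \<Rightarrow> complex" where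
  "bdiffs K ns f = foldr (\<lambda>n. bdiff n ^^ K) ns f"

text \<open>The one-variable counterpart of \<open>bdiff\<close>, which appears when all coordinates
  but one are frozen.\<close>

definition bdiff1 :: "(nat \<Rightarrow> complex) \<Rightarrow> nat \<Rightarrow> complex" where
  "bdiff1 h j = h j - (if 1 < j then h (j - 1) else 0)"

section \<open>Algebra of backward differences\<close>

lemma bdiff_commute: "bdiff n (bdiff p f) = bdiff p (bdiff n f)"
  by (cases "n = p") (auto simp: bdiff_def fun_eq_iff fun_upd_twist)

lemma bdiff_pow_commute: "(bdiff n ^^ K) (bdiff p f) = bdiff p ((bdiff n ^^ K) f)"
  by (induction K) (simp_all add: bdiff_commute)

lemma bdiff_pow_foldr: "(bdiff n ^^ K) (foldr bdiff ns f) = foldr bdiff ns ((bdiff n ^^ K) f)"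
  by (induction ns) (simp_all add: bdiff_pow_commute)

lemma bdiffs_0: "bdiffs 0 ns f = f"
  by (induction ns) (auto simp: bdiffs_def)

text \<open>Since differences in all directions commute, one further difference per direction can be
  moved outermost. This is the form needed to raise the order of a summation by one.\<close>

lemma bdiffs_Suc: "bdiffs (Suc K) ns f = foldr bdiff ns (bdiffs K ns f)"
proof (induction ns)
  case (Cons n ns)
  have "bdiffs (Suc K) (n # ns) f = bdiff n ((bdiff n ^^ K) (bdiffs (Suc K) ns f))"
    by (simp add: bdiffs_def)
  also have "\<dots> = bdiff n (foldr bdiff ns ((bdiff n ^^ K) (bdiffs K ns f)))"
    by (simp only: Cons bdiff_pow_foldr)
  finally show ?case by (simp add: bdiffs_def)
qed (simp add: bdiffs_def)

text \<open>A transfer principle: the differenced value arises by repeated subtraction from values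
  at points that are again positive on \<open>V\<close>. It is used for holomorphy in a summation
  variable, for entireness in \<open>s\<close>, and for equality of two functions.\<close>

lemma bdiff_pow_closed:
  assumes diff: "\<And>f g. Q f \<Longrightarrow> Q g \<Longrightarrow> Q (\<lambda>z. f z - g z)"
    and F: "\<And>m. (\<forall>i\<in>V. 1 \<le> m i) \<Longrightarrow> Q (\<lambda>z. F z m)" and m: "\<forall>i\<in>V. 1 \<le> m i"
  shows "Q (\<lambda>z. (bdiff n ^^ K) (F z) m)"
  using m
proof (induction K arbitrary: m)
  case (Suc K)
  show ?case
  proof (cases "1 < m n")
    case True
    then have "\<forall>i\<in>V. 1 \<le> (m(n := m n - 1)) i" using Suc.prems by auto
    from diff[OF Suc.IH[OF Suc.prems] Suc.IH[OF this]] True show ?thesis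
      by (simp add: bdiff_def[of n "(bdiff n ^^ K) (F z)" m for z] del: fun_upd_apply)
  qed (use Suc in \<open>simp add: bdiff_def[of n "(bdiff n ^^ K) (F z)" m for z]\<close>)
qed (use F in auto)

lemma bdiffs_closed:
  assumes diff: "\<And>f g. Q f \<Longrightarrow> Q g \<Longrightarrow> Q (\<lambda>z. f z - g z)"
    and F: "\<And>m. (\<forall>i\<in>V. 1 \<le> m i) \<Longrightarrow> Q (\<lambda>z. F z m)" and m: "\<forall>i\<in>V. 1 \<le> m i"
  shows "Q (\<lambda>z. bdiffs K ns (F z) m)"
  using m
proof (induction ns arbitrary: m)
  case (Cons n ns)
  have "Q (\<lambda>z. (bdiff n ^^ K) (bdiffs K ns (F z)) m)"
    by (rule bdiff_pow_closed[of Q V "\<lambda>z. bdiffs K ns (F z)"]) (use diff Cons in auto)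
  then show ?case by (simp add: bdiffs_def)
qed (simp add: bdiffs_def F)

lemma bdiff_pow_slice: "(bdiff n ^^ K) F (m(n := j)) = (bdiff1 ^^ K) (\<lambda>j. F (m(n := j))) j"
  by (induction K arbitrary: j) (simp_all add: bdiff_def bdiff1_def)

lemma bdiff_pow_upd:
  "p \<noteq> n \<Longrightarrow> (bdiff p ^^ K) f (m(n := j)) = (bdiff p ^^ K) (\<lambda>m. f (m(n := j))) m"
proof (induction K arbitrary: m)
  case (Suc K)
  then show ?case
    by (simp add: bdiff_def[of p] fun_upd_twist[of n p] del: fun_upd_apply) (simp add: fun_upd_def)
qed simp

text \<open>Freezing a coordinate outside \<open>ns\<close> commutes with the differences, so an
  induction over directions may treat that coordinate as a parameter.\<close>

lemma bdiffs_upd: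
  "n \<notin> set ns \<Longrightarrow> bdiffs K ns f (m(n := j)) = bdiffs K ns (\<lambda>m. f (m(n := j))) m"
proof (induction ns arbitrary: m)
  case (Cons p ns)
  then have "bdiffs K (p # ns) f (m(n := j)) = (bdiff p ^^ K) (\<lambda>m. bdiffs K ns f (m(n := j))) m"
    using bdiff_pow_upd[of p n K "bdiffs K ns f" m j] Cons.prems
    by (auto simp: bdiffs_def simp del: fun_upd_apply)
  also have "\<dots> = (bdiff p ^^ K) (bdiffs K ns (\<lambda>m. f (m(n := j)))) m"
    using Cons by (simp del: fun_upd_apply)
  finally show ?case by (simp add: bdiffs_def del: fun_upd_apply)
qed (simp add: bdiffs_def)

section \<open>Decay of iterated differences of holomorphic functions\<close>

text \<open>The crude bound, each difference at most doubling the size. It covers arguments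
  \<open>j\<close> too small compared with \<open>K\<close> for Cauchy's estimates.\<close>

lemma bdiff1_pow_norm_le:
  assumes "\<And>i. 1 \<le> i \<Longrightarrow> i \<le> j \<Longrightarrow> norm (h i) \<le> B" "1 \<le> j"
  shows "norm ((bdiff1 ^^ K) h j) \<le> 2 ^ K * B"
  using assms
proof (induction K arbitrary: j)
  case (Suc K)
  have a: "norm ((bdiff1 ^^ K) h j) \<le> 2 ^ K * B" using Suc by blast
  have B: "0 \<le> 2 ^ K * B" using a norm_ge_zero order_trans by blast
  have b: "1 < j \<Longrightarrow> norm ((bdiff1 ^^ K) h (j - 1)) \<le> 2 ^ K * B" using Suc by auto
  show ?case
  proof (cases "1 < j")
    case True
    then show ?thesis
      using norm_triangle_ineq4[of "(bdiff1 ^^ K) h j" "(bdiff1 ^^ K) h (j - 1)"] a b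
      by (simp add: bdiff1_def[of "(bdiff1 ^^ K) h"])
  qed (use a B in \<open>simp add: bdiff1_def[of "(bdiff1 ^^ K) h"]\<close>)
qed auto

text \<open>As \<open>K < j\<close>, the \<open>K\<close> backward shifts stay at arguments at least
  1 and never meet the extension by zero.\<close>

lemma bdiff1_pow_of_nat:
  fixes h :: "complex \<Rightarrow> complex"
  shows
  "K < j \<Longrightarrow> (bdiff1 ^^ K) (\<lambda>j. h (of_nat j)) j = ((\<lambda>g z. g z - g (z - 1)) ^^ K) h (of_nat j)"
proof (induction K arbitrary: j)
  case (Suc K)
  have eq: "(of_nat (j - 1) :: complex) = of_nat j - 1" using Suc.prems by (simp add: of_nat_diff)
  have "K < j" "K < j - 1" "1 < j" using Suc.prems by auto
  note IH = Suc.IH[OF this(1)] Suc.IH[OF this(2)] and j = this(3)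
  show ?case
    unfolding funpow.simps o_apply bdiff1_def[of "(bdiff1 ^^ K) _"] IH using j by (simp only: eq if_True)
qed simp

text \<open>The difference is bounded by the supremum of \<open>deriv g\<close>, and Cauchy's
  estimate on discs of radius \<open>\<sigma> / 2\<close> bounds that by
  \<open>2 * B / \<sigma>\<close>. The lost radius \<open>\<sigma>\<close> pays for the unit shift
  and for these discs, which requires \<open>1 + \<sigma> / 2 \<le> \<sigma>\<close>.\<close>

lemma holomorphic_diff_step:
  assumes g: "g holomorphic_on ball w R" and B: "\<And>z. z \<in> ball w R \<Longrightarrow> norm (g z) \<le> B"
    and \<sigma>: "\<sigma> \<ge> (2::real)"
  shows "(\<lambda>z. g z - g (z - 1)) holomorphic_on ball w (R - \<sigma>)"
    and "z \<in> ball w (R - \<sigma>) \<Longrightarrow> norm (g z - g (z - 1)) \<le> B * (2 / \<sigma>)"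
proof -
  have m1: "z - 1 \<in> ball w (R - \<sigma> + 1)" if "z \<in> ball w (R - \<sigma>)" for z
    using that norm_triangle_ineq[of "w - z" 1] by (simp add: dist_norm algebra_simps)
  have m2: "ball w (R - \<sigma>) \<subseteq> ball w (R - \<sigma> + 1)" "ball w (R - \<sigma> + 1) \<subseteq> ball w R"
    using \<sigma> by (auto intro: subset_ball)
  show "(\<lambda>z. g z - g (z - 1)) holomorphic_on ball w (R - \<sigma>)"
  proof (rule holomorphic_on_diff)
    show "g holomorphic_on ball w (R - \<sigma>)" using g m2 holomorphic_on_subset by blast
    have "(g \<circ> (\<lambda>z. z - 1)) holomorphic_on ball w (R - \<sigma>)"
      by (rule holomorphic_on_compose_gen[OF _ g]) (use m1 m2 in \<open>auto intro: holomorphic_intros\<close>)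
    then show "(\<lambda>z. g (z - 1)) holomorphic_on ball w (R - \<sigma>)" by (simp add: o_def)
  qed
  assume z: "z \<in> ball w (R - \<sigma>)"
  have "norm (g z - g (z - 1)) \<le> B * (2 / \<sigma>) * norm (z - (z - 1))"
  proof (rule field_differentiable_bound[of "ball w (R - \<sigma> + 1)"])
    fix x assume x: "x \<in> ball w (R - \<sigma> + 1)"
    have cb: "cball x (\<sigma> / 2) \<subseteq> ball w R"
    proof
      fix y assume "y \<in> cball x (\<sigma> / 2)"
      then have "dist w y < (R - \<sigma> + 1) + \<sigma> / 2"
        using x dist_triangle[of w y x] by (simp add: dist_commute)
      then show "y \<in> ball w R" using \<sigma> by simp
    qed
    have hol: "g holomorphic_on cball x (\<sigma> / 2)" using g cb holomorphic_on_subset by blast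
    have "norm ((deriv ^^ 1) g x) \<le> fact 1 * B / (\<sigma> / 2) ^ 1"
    proof (rule Cauchy_inequality)
      show "g holomorphic_on ball x (\<sigma> / 2)" using hol holomorphic_on_subset ball_subset_cball by blast
      show "norm (g y) \<le> B" if "norm (x - y) = \<sigma> / 2" for y
        using cb B that by (auto simp: dist_norm)
    qed (use \<sigma> hol holomorphic_on_imp_continuous_on in auto)
    then show "norm (deriv g x) \<le> B * (2 / \<sigma>)" using \<sigma> by (simp add: field_simps)
    show "(g has_field_derivative deriv g x) (at x within ball w (R - \<sigma> + 1))"
      by (rule has_field_derivative_at_within, rule holomorphic_derivI[OF g]) (use x m2 in auto)
  qed (use z m1 m2 in auto)
  then show "norm (g z - g (z - 1)) \<le> B * (2 / \<sigma>)" by simp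
qed

lemma holomorphic_diff_pow:
  assumes g: "g holomorphic_on ball w R" and B: "\<And>z. z \<in> ball w R \<Longrightarrow> norm (g z) \<le> B"
    and \<sigma>: "\<sigma> \<ge> (2::real)"
  shows "((\<lambda>g z. g z - g (z - 1)) ^^ K) g holomorphic_on ball w (R - K * \<sigma>) \<and>
    (\<forall>z\<in>ball w (R - K * \<sigma>). norm (((\<lambda>g z. g z - g (z - 1)) ^^ K) g z) \<le> B * (2 / \<sigma>) ^ K)"
proof (induction K)
  case (Suc K)
  have eq: "R - real (Suc K) * \<sigma> = R - real K * \<sigma> - \<sigma>" by (simp add: algebra_simps)
  have *: "B * (2 / \<sigma>) ^ Suc K = B * (2 / \<sigma>) ^ K * (2 / \<sigma>)" by simp
  show ?case unfolding eq * funpow.simps o_def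
    using holomorphic_diff_step[of _ w "R - K * \<sigma>" "B * (2 / \<sigma>) ^ K", OF _ _ \<sigma>] Suc by blast
qed (use assms in auto)

text \<open>Each difference gains a factor of order \<open>K / j\<close>. For
  \<open>8 * K \<le> j\<close> this comes from Cauchy's estimates on the disc of radius
  \<open>j / 2\<close> about \<open>j\<close>; for smaller \<open>j\<close> the claimed gain is
  weaker than the trivial factor 2 per difference.\<close>

lemma bdiff1_pow_holomorphic_bound:
  assumes h: "h holomorphic_on {z. Re z > 1/2}" and j: "1 \<le> j"
    and B: "\<And>z. Re z > 1/2 \<Longrightarrow> norm z < 2 * real j \<Longrightarrow> norm (h z) \<le> B"
  shows "norm ((bdiff1 ^^ K) (\<lambda>j. h (of_nat j)) j) \<le> B * ((16 * real K) ^ K / real j ^ K)"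
proof (cases "K = 0")
  case True
  then show ?thesis using B[of "of_nat j"] j by simp
next
  case K: False
  show ?thesis
  proof (cases "j < 8 * K")
    case True
    have B0: "0 \<le> B" by (rule order_trans[OF norm_ge_zero B[of "of_nat j"]]) (use j in auto)
    have "norm ((bdiff1 ^^ K) (\<lambda>j. h (of_nat j)) j) \<le> 2 ^ K * B"
      by (rule bdiff1_pow_norm_le) (use B j in auto)
    \<comment> \<open>Here \<open>j < 8 * K\<close> gives \<open>2 \<le> 16 * K / j\<close>.\<close>
    also have "2 ^ K \<le> (16 * real K) ^ K / real j ^ K"
      unfolding power_divide[symmetric] using True j by (intro power_mono) (auto simp: field_simps)
    finally show ?thesis using B0 by (simp add: mult_right_mono mult.commute)
  next
    case False
    \<comment> \<open>The \<open>K\<close> steps consume \<open>K * \<sigma> = j / 4\<close> of the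
      radius \<open>j / 2\<close>, so the centre remains in the final ball.\<close>
    define \<sigma> where "\<sigma> = real j / (4 * real K)"
    have \<sigma>: "\<sigma> \<ge> 2" using False K unfolding \<sigma>_def by (simp add: field_simps)
    have sub: "Re z > 1/2 \<and> norm z < 2 * real j" if "z \<in> ball (of_nat j) (real j / 2)" for z
    proof -
      have "norm (of_nat j - z) < real j / 2" using that by (simp add: dist_norm)
      then have "\<bar>real j - Re z\<bar> < real j / 2" "norm z < real j + real j / 2"
        using abs_Re_le_cmod[of "of_nat j - z"] norm_triangle_ineq4[of "of_nat j" "of_nat j - z"]
        by auto
      moreover have "1 \<le> real j" using j by simp
      ultimately show ?thesis by (intro conjI; linarith)
    qed
    have "K < j" using False K by simp
    moreover have "of_nat j \<in> ball (of_nat j :: complex) (real j / 2 - real K * \<sigma>)"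
      using j K by (simp add: \<sigma>_def)
    moreover have "h holomorphic_on ball (of_nat j) (real j / 2)"
      by (rule holomorphic_on_subset[OF h]) (use sub in auto)
    ultimately have "norm ((bdiff1 ^^ K) (\<lambda>j. h (of_nat j)) j) \<le> B * (2 / \<sigma>) ^ K"
      using holomorphic_diff_pow[of h "of_nat j" "real j / 2" B \<sigma> K] \<sigma> B sub bdiff1_pow_of_nat
      by auto
    also have "\<dots> \<le> B * ((16 * real K) ^ K / real j ^ K)"
    proof -
      have B0: "0 \<le> B" by (rule order_trans[OF norm_ge_zero B[of "of_nat j"]]) (use j in auto)
      have "2 / \<sigma> \<le> 16 * real K / real j" using j by (simp add: \<sigma>_def field_simps)
      then have "(2 / \<sigma>) ^ K \<le> (16 * real K / real j) ^ K" using \<sigma> by (intro power_mono) auto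
      then have "(2 / \<sigma>) ^ K \<le> (16 * real K) ^ K / real j ^ K" by (simp only: power_divide)
      then show ?thesis using B0 by (rule mult_left_mono)
    qed
    finally show ?thesis .
  qed
qed

text \<open>Induction over the directions: the first variable becomes a complex parameter
  \<open>z\<close>, the induction hypothesis bounds the remaining differences uniformly in
  \<open>z\<close>, and the one-variable bound is applied in \<open>z\<close>. Coordinates outside
  \<open>ns\<close> are fixed at the integers \<open>m i\<close>, so the bound hypothesis passes to
  the shorter list.\<close>

lemma bdiffs_holomorphic_bound:
  fixes g :: "('n \<Rightarrow> complex) \<Rightarrow> complex"
  assumes "distinct ns" "\<forall>n\<in>set ns. 1 \<le> m n"
    and "\<And>n w. n \<in> set ns \<Longrightarrow> \<forall>i\<in>set ns. Re (w i) > 1/2 \<Longrightarrow>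
      (\<lambda>z. g (w(n := z))) holomorphic_on {z. Re z > 1/2}"
    and "\<And>w. \<forall>i\<in>set ns. Re (w i) > 1/2 \<and> norm (w i) < 2 * real (m i) \<Longrightarrow>
      \<forall>i. i \<notin> set ns \<longrightarrow> w i = of_nat (m i) \<Longrightarrow> norm (g w) \<le> B"
  shows "norm (bdiffs K ns (\<lambda>m. g (\<lambda>i. of_nat (m i))) m)
    \<le> B * (\<Prod>n\<in>set ns. (16 * real K) ^ K / real (m n) ^ K)"
  using assms
proof (induction ns arbitrary: g m B)
  case Nil
  then show ?case using Nil.prems(4)[of "\<lambda>i. of_nat (m i)"] by (simp add: bdiffs_def)
next
  case (Cons n ns)
  note hol = Cons.prems(3) and bnd = Cons.prems(4)
  have n: "n \<notin> set ns" "1 \<le> m n" using Cons.prems by auto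
  define h where "h z = bdiffs K ns (\<lambda>m'. g ((\<lambda>i. of_nat (m' i))(n := z))) m" for z
  define C where "C = (\<Prod>n\<in>set ns. (16 * real K) ^ K / real (m n) ^ K)"
  have "h holomorphic_on {z. Re z > 1/2}"
    unfolding h_def
  proof (rule bdiffs_closed[where V = "set ns" and Q = "\<lambda>f. f holomorphic_on {z. Re z > 1/2}"
        and F = "\<lambda>z m'. g ((\<lambda>i. of_nat (m' i))(n := z))"])
    fix m' :: "'n \<Rightarrow> nat" assume m': "\<forall>i\<in>set ns. 1 \<le> m' i"
    show "(\<lambda>z. g ((\<lambda>i. of_nat (m' i))(n := z))) holomorphic_on {z. 1 / 2 < Re z}"
    proof -
      \<comment> \<open>The value 1 at \<open>n\<close> is a placeholder inside the half plane that
        is overwritten by \<open>z\<close>; the coordinate \<open>m' n\<close> itself might be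
        0.\<close>
      have "1/2 < Re (((\<lambda>i. of_nat (m' i))(n := 1)) i)" if "i \<in> set (n # ns)" for i
        using m' that of_nat_mono[of 1 "m' i", where 'a = real] by auto
      then have "\<forall>i\<in>set (n # ns). 1/2 < Re (((\<lambda>i. of_nat (m' i))(n := 1)) i)" by blast
      from hol[OF _ this, of n] show ?thesis by (simp only: fun_upd_upd list.set_intros)
    qed
  qed (use Cons.prems(2) in \<open>auto intro: holomorphic_intros\<close>)
  moreover have "norm (h z) \<le> B * C" if z: "Re z > 1/2" "norm z < 2 * real (m n)" for z
    unfolding h_def C_def
  proof (rule Cons.IH[of m "\<lambda>w. g (w(n := z))"])
    show "(\<lambda>x. g ((w(p := x))(n := z))) holomorphic_on {z. 1/2 < Re z}"
      if "p \<in> set ns" "\<forall>i\<in>set ns. 1/2 < Re (w i)" for p w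
    proof -
      have "(w(p := x))(n := z) = (w(n := z))(p := x)" for x using n that by auto
      moreover have "\<forall>i\<in>set (n # ns). 1/2 < Re ((w(n := z)) i)" using that z by auto
      ultimately show ?thesis using hol[of p "w(n := z)"] that by (simp del: fun_upd_apply)
    qed
    show "norm (g (w(n := z))) \<le> B"
      if "\<forall>i\<in>set ns. 1/2 < Re (w i) \<and> norm (w i) < 2 * real (m i)" 
        "\<forall>i. i \<notin> set ns \<longrightarrow> w i = of_nat (m i)" for w
      by (rule bnd) (use that z in auto)
  qed (use Cons.prems(1,2) in auto)
  ultimately have "norm ((bdiff1 ^^ K) (\<lambda>j. h (of_nat j)) (m n))
      \<le> B * C * ((16 * real K) ^ K / real (m n) ^ K)"
    using bdiff1_pow_holomorphic_bound[of h "m n" "B * C" K] n by blast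
  moreover have "bdiffs K (n # ns) (\<lambda>m. g (\<lambda>i. of_nat (m i))) m
      = (bdiff1 ^^ K) (\<lambda>j. h (of_nat j)) (m n)"
  proof -
    have eq: "(\<lambda>i. of_nat ((m'(n := j)) i)) = (\<lambda>i. of_nat (m' i))(n := of_nat j)"
      for m' :: "'n \<Rightarrow> nat" and j by auto
    have "bdiffs K (n # ns) (\<lambda>m. g (\<lambda>i. of_nat (m i))) m
        = (bdiff n ^^ K) (bdiffs K ns (\<lambda>m. g (\<lambda>i. of_nat (m i)))) (m(n := m n))"
      by (simp add: bdiffs_def)
    also have "\<dots> = (bdiff1 ^^ K) (\<lambda>j. bdiffs K ns (\<lambda>m. g (\<lambda>i. of_nat (m i))) (m(n := j))) (m n)"
      by (rule bdiff_pow_slice)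
    also have "\<dots> = (bdiff1 ^^ K) (\<lambda>j. h (of_nat j)) (m n)"
      by (simp only: bdiffs_upd[OF n(1)] eq h_def)
    finally show ?thesis .
  qed
  ultimately have "norm (bdiffs K (n # ns) (\<lambda>m. g (\<lambda>i. of_nat (m i))) m)
      \<le> B * C * ((16 * real K) ^ K / real (m n) ^ K)" by simp
  also have "\<dots> = B * (\<Prod>n\<in>set (n # ns). (16 * real K) ^ K / real (m n) ^ K)"
    using n by (simp add: C_def)
  finally show ?case .
qed

section \<open>Regularised sums\<close>

text \<open>The order \<open>K\<close> is existential because the number of differences needed
  depends on the growth of \<open>f\<close>. Division by the power of the product is avoided by
  placing it on the side of \<open>X\<close>.\<close>

definition reg_sum ::
    "'n list \<Rightarrow> ('n \<Rightarrow> complex) \<Rightarrow> (('n \<Rightarrow> nat) \<Rightarrow> complex) \<Rightarrow> complex \<Rightarrow> bool" where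
  "reg_sum ns \<mu> f X \<longleftrightarrow> (\<exists>K. ((\<lambda>m. (\<Prod>n\<in>set ns. \<mu> n ^ m n) * bdiffs K ns f m) has_sum
     (\<Prod>n\<in>set ns. 1 - \<mu> n) ^ K * X) (set ns \<rightarrow>\<^sub>E {1..}))"

text \<open>Summation by parts: raising \<open>m n\<close> by one multiplies the weight by
  \<open>\<mu> n\<close> and maps the index set onto the points with \<open>1 < m n\<close>. The
  shifted summand vanishes at the other points, so no boundary term appears.\<close>

lemma has_sum_bdiff:
  assumes V: "finite V" "n \<in> V"
    and f: "((\<lambda>m. (\<Prod>i\<in>V. \<mu> i ^ m i) * f m) has_sum X) (V \<rightarrow>\<^sub>E {1..})"
  shows "((\<lambda>m. (\<Prod>i\<in>V. \<mu> i ^ m i) * bdiff n f m) has_sum (1 - \<mu> n) * X) (V \<rightarrow>\<^sub>E {1..})"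
proof -
  let ?A = "V \<rightarrow>\<^sub>E {1::nat..}"
  define G where "G m = (\<Prod>i\<in>V. \<mu> i ^ m i) * (if 1 < m n then f (m(n := m n - 1)) else 0)" for m
  have G: "G (m(n := Suc (m n))) = \<mu> n * ((\<Prod>i\<in>V. \<mu> i ^ m i) * f m)" if "m \<in> ?A" for m
  proof -
    have "(\<Prod>i\<in>V. \<mu> i ^ (m(n := Suc (m n))) i) = \<mu> n * (\<Prod>i\<in>V. \<mu> i ^ m i)"
      using V by (simp add: prod.remove[OF V] cong: prod.cong_simp)
    then show ?thesis using V that by (auto simp: G_def PiE_iff)
  qed
  have "((\<lambda>m. \<mu> n * ((\<Prod>i\<in>V. \<mu> i ^ m i) * f m)) has_sum \<mu> n * X) ?A"
    by (rule has_sum_cmult_right[OF f])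
  also have "?this \<longleftrightarrow> (G has_sum \<mu> n * X) {m \<in> ?A. 1 < m n}"
    by (rule has_sum_reindex_bij_witness[of _ "\<lambda>m. m(n := m n - 1)" "\<lambda>m. m(n := Suc (m n))"])
      (use V G in \<open>auto simp: PiE_iff extensional_def\<close>)
  also have "\<dots> \<longleftrightarrow> (G has_sum \<mu> n * X) ?A"
    by (rule has_sum_cong_neutral) (auto simp: G_def)
  finally have "((\<lambda>m. (\<Prod>i\<in>V. \<mu> i ^ m i) * f m - G m) has_sum X - \<mu> n * X) ?A"
    by (intro has_sum_diff f)
  then show ?thesis by (simp add: G_def bdiff_def algebra_simps)
qed

lemma has_sum_bdiffs_Suc:
  assumes "distinct ns" "((\<lambda>m. (\<Prod>n\<in>set ns. \<mu> n ^ m n) * bdiffs K ns f m) has_sum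
     (\<Prod>n\<in>set ns. 1 - \<mu> n) ^ K * X) (set ns \<rightarrow>\<^sub>E {1..})"
  shows "((\<lambda>m. (\<Prod>n\<in>set ns. \<mu> n ^ m n) * bdiffs (Suc K) ns f m) has_sum
     (\<Prod>n\<in>set ns. 1 - \<mu> n) ^ Suc K * X) (set ns \<rightarrow>\<^sub>E {1..})"
proof -
  \<comment> \<open>Differences are added one direction at a time along \<open>xs\<close>, each
    contributing its factor, while the weights and the index set remain those of the full list
    \<open>ns\<close>.\<close>
  have "((\<lambda>m. (\<Prod>n\<in>set ns. \<mu> n ^ m n) * foldr bdiff xs (bdiffs K ns f) m) has_sum
     (\<Prod>n\<in>set xs. 1 - \<mu> n) * ((\<Prod>n\<in>set ns. 1 - \<mu> n) ^ K * X)) (set ns \<rightarrow>\<^sub>E {1..})"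
    if "set xs \<subseteq> set ns" "distinct xs" for xs
    using that
  proof (induction xs)
    case (Cons x xs)
    then show ?case using has_sum_bdiff[of "set ns" x \<mu> "foldr bdiff xs (bdiffs K ns f)"]
      by (simp add: mult.assoc)
  qed (use assms in simp)
  from this[of ns] assms show ?thesis by (simp add: bdiffs_Suc mult.assoc)
qed

lemma has_sum_bdiffs_mono:
  assumes "distinct ns" "((\<lambda>m. (\<Prod>n\<in>set ns. \<mu> n ^ m n) * bdiffs K ns f m) has_sum
     (\<Prod>n\<in>set ns. 1 - \<mu> n) ^ K * X) (set ns \<rightarrow>\<^sub>E {1..})" "K \<le> K'"
  shows "((\<lambda>m. (\<Prod>n\<in>set ns. \<mu> n ^ m n) * bdiffs K' ns f m) has_sum
     (\<Prod>n\<in>set ns. 1 - \<mu> n) ^ K' * X) (set ns \<rightarrow>\<^sub>E {1..})"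
  using assms(3) by (induction K' rule: dec_induct) (use assms has_sum_bdiffs_Suc in blast)+

text \<open>Two witnesses are compared at a common order \<open>K\<close>, where ordinary sums are
  unique; the factor in front is nonzero because no \<open>\<mu> n\<close> equals 1.\<close>

lemma reg_sum_unique:
  assumes ns: "distinct ns" "\<And>n. \<mu> n \<noteq> 1" and X: "reg_sum ns \<mu> f X" and Y: "reg_sum ns \<mu> f Y"
  shows "X = Y"
proof -
  obtain K L where
    "((\<lambda>m. (\<Prod>n\<in>set ns. \<mu> n ^ m n) * bdiffs K ns f m) has_sum
     (\<Prod>n\<in>set ns. 1 - \<mu> n) ^ K * X) (set ns \<rightarrow>\<^sub>E {1..})"
    "((\<lambda>m. (\<Prod>n\<in>set ns. \<mu> n ^ m n) * bdiffs L ns f m) has_sum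
     (\<Prod>n\<in>set ns. 1 - \<mu> n) ^ L * Y) (set ns \<rightarrow>\<^sub>E {1..})"
    using X Y unfolding reg_sum_def by blast
  from this[THEN has_sum_bdiffs_mono[OF ns(1), where K' = "max K L"]]
  have "(\<Prod>n\<in>set ns. 1 - \<mu> n) ^ max K L * X = (\<Prod>n\<in>set ns. 1 - \<mu> n) ^ max K L * Y"
    using has_sum_unique by (meson max.cobounded1 max.cobounded2)
  moreover have "(\<Prod>n\<in>set ns. 1 - \<mu> n) \<noteq> 0" using ns by simp
  ultimately show ?thesis by (metis mult_cancel_left power_not_zero)
qed

lemma bdiff_pow_add:
  "(bdiff n ^^ K) (\<lambda>m. f m + g m) = (\<lambda>m. (bdiff n ^^ K) f m + (bdiff n ^^ K) g m)"
  by (induction K) (auto simp: bdiff_def fun_eq_iff)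

lemma bdiffs_add: "bdiffs K ns (\<lambda>m. f m + g m) = (\<lambda>m. bdiffs K ns f m + bdiffs K ns g m)"
  by (induction ns) (auto simp: bdiffs_def bdiff_pow_add)

lemma bdiff_pow_cmult: "(bdiff n ^^ K) (\<lambda>m. c * f m) = (\<lambda>m. c * (bdiff n ^^ K) f m)"
  by (induction K) (auto simp: bdiff_def fun_eq_iff algebra_simps)

lemma bdiffs_cmult: "bdiffs K ns (\<lambda>m. c * f m) = (\<lambda>m. c * bdiffs K ns f m)"
  by (induction ns) (auto simp: bdiffs_def bdiff_pow_cmult)

lemma reg_sum_cmult:
  assumes "reg_sum ns \<mu> f X" shows "reg_sum ns \<mu> (\<lambda>m. c * f m) (c * X)"
proof -
  obtain K where "((\<lambda>m. (\<Prod>n\<in>set ns. \<mu> n ^ m n) * bdiffs K ns f m) has_sum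
     (\<Prod>n\<in>set ns. 1 - \<mu> n) ^ K * X) (set ns \<rightarrow>\<^sub>E {1..})"
    using assms unfolding reg_sum_def by blast
  from has_sum_cmult_right[OF this, of c] show ?thesis
    unfolding reg_sum_def by (auto intro!: exI[of _ K] simp: bdiffs_cmult mult_ac)
qed

lemma reg_sum_add:
  assumes ns: "distinct ns" and f: "reg_sum ns \<mu> f X" and g: "reg_sum ns \<mu> g Y"
  shows "reg_sum ns \<mu> (\<lambda>m. f m + g m) (X + Y)"
proof -
  obtain K L where
    "((\<lambda>m. (\<Prod>n\<in>set ns. \<mu> n ^ m n) * bdiffs K ns f m) has_sum
     (\<Prod>n\<in>set ns. 1 - \<mu> n) ^ K * X) (set ns \<rightarrow>\<^sub>E {1..})"
    "((\<lambda>m. (\<Prod>n\<in>set ns. \<mu> n ^ m n) * bdiffs L ns g m) has_sum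
     (\<Prod>n\<in>set ns. 1 - \<mu> n) ^ L * Y) (set ns \<rightarrow>\<^sub>E {1..})"
    using f g unfolding reg_sum_def by blast
  from has_sum_add[OF this[THEN has_sum_bdiffs_mono[OF ns, where K' = "max K L"]]]
  show ?thesis unfolding reg_sum_def by (auto intro!: exI[of _ "max K L"] simp: bdiffs_add distrib_left)
qed

lemma reg_sum_sum:
  assumes ns: "distinct ns" and "finite I" and f: "\<And>i. i \<in> I \<Longrightarrow> reg_sum ns \<mu> (f i) (X i)"
  shows "reg_sum ns \<mu> (\<lambda>m. \<Sum>i\<in>I. f i m) (\<Sum>i\<in>I. X i)"
  using assms(2) f
proof (induction I)
  case empty
  show ?case unfolding reg_sum_def by (intro exI[of _ 0]) (simp add: bdiffs_0)
next
  case (insert i I)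
  then show ?case by (simp add: reg_sum_add[OF ns])
qed

lemma bdiffs_cong:
  assumes "\<And>m. \<forall>i\<in>V. 1 \<le> m i \<Longrightarrow> f m = g m" "\<forall>i\<in>V. 1 \<le> m i"
  shows "bdiffs K ns f m = bdiffs K ns g m"
  \<comment> \<open>the pair \<open>(f, g)\<close> is encoded as a family indexed by \<open>bool\<close>\<close>
  using bdiffs_closed[where Q = "\<lambda>h. h True = h False" and F = "\<lambda>b. if b then f else g", OF _ _ assms(2)]
    assms(1) by simp

text \<open>Identities between summands need hold only at positive points, which matters for rules
  about \<open>powr\<close> that require a nonzero base.\<close>

lemma reg_sum_cong:
  assumes "\<And>m. \<forall>i\<in>set ns. 1 \<le> m i \<Longrightarrow> f m = g m"
  shows "reg_sum ns \<mu> f X \<longleftrightarrow> reg_sum ns \<mu> g X"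
proof -
  have "bdiffs K ns f m = bdiffs K ns g m" if "m \<in> set ns \<rightarrow>\<^sub>E {1..}" for K m
    by (rule bdiffs_cong[OF assms]) (use PiE_mem[OF that] in auto)
  then show ?thesis unfolding reg_sum_def by (intro ex_cong1 has_sum_cong) simp
qed

section \<open>Series attached to affine forms\<close>

text \<open>A finite set of points lies in the box of its coordinate projections, over which the sum
  factorises into one-variable sums.\<close>

lemma summable_on_prod_inverse_squares:
  assumes "finite V"
  shows "(\<lambda>m. \<Prod>n\<in>V. 1 / real (m n) ^ 2) summable_on (V \<rightarrow>\<^sub>E {1..})"
proof (rule nonneg_bdd_above_summable_on)
  have sq: "(\<lambda>j. 1 / real j ^ 2) summable_on UNIV"
    using inverse_power_summable[of 2, where 'a = real]
    by (intro norm_summable_imp_summable_on) (simp add: inverse_eq_divide)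
  let ?C = "(\<Sum>\<^sub>\<infinity>j\<in>UNIV. 1 / real j ^ 2) ^ card V"
  show "bdd_above (sum (\<lambda>m. \<Prod>n\<in>V. 1 / real (m n) ^ 2) ` {F. F \<subseteq> V \<rightarrow>\<^sub>E {1..} \<and> finite F})"
  proof (rule bdd_aboveI2)
    fix F assume F: "F \<in> {F. F \<subseteq> V \<rightarrow>\<^sub>E {1::nat..} \<and> finite F}"
    define B where "B n = (\<lambda>m. m n) ` F" for n
    have "(\<Sum>m\<in>F. \<Prod>n\<in>V. 1 / real (m n) ^ 2) \<le> (\<Sum>m\<in>PiE V B. \<Prod>n\<in>V. 1 / real (m n) ^ 2)"
    proof (rule sum_mono2)
      show "F \<subseteq> PiE V B" using F by (auto simp: B_def PiE_iff)
      show "finite (PiE V B)" using F assms by (auto simp: B_def intro: finite_PiE)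
    qed (auto intro: prod_nonneg)
    also have "\<dots> = (\<Prod>n\<in>V. \<Sum>j\<in>B n. 1 / real j ^ 2)"
      using F assms by (subst prod_sum_PiE) (auto simp: B_def)
    also have "\<dots> \<le> (\<Prod>n\<in>V. \<Sum>\<^sub>\<infinity>j\<in>UNIV. 1 / real j ^ 2)"
      using F sq by (intro prod_mono) (auto intro!: sum_nonneg finite_sum_le_infsum simp: B_def)
    finally show "(\<Sum>m\<in>F. \<Prod>n\<in>V. 1 / real (m n) ^ 2) \<le> ?C" by simp
  qed
qed (auto intro: prod_nonneg)

text \<open>The number \<open>y\<close> controls both \<open>norm p\<close> and its inverse, so
  \<open>norm (Ln p)\<close> is at most \<open>ln y + pi\<close>. The result is polynomial in
  \<open>y\<close>, uniformly for \<open>z\<close> in a disc.\<close>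

lemma norm_powr_le:
  fixes p z :: complex
  assumes z: "norm z \<le> real M" and y: "1 / y \<le> norm p" "norm p \<le> y" "1 \<le> y"
  shows "norm (p powr z) \<le> exp (M * pi) * y ^ M"
proof -
  have "0 < norm p" using y by (smt (verit) zero_less_divide_1_iff)
  then have p: "p \<noteq> 0" by auto
  have "norm (Ln p) \<le> \<bar>Re (Ln p)\<bar> + \<bar>Im (Ln p)\<bar>" by (rule cmod_le)
  also have "\<dots> \<le> ln y + pi"
  proof (rule add_mono)
    have "ln (norm p) \<le> ln y" using p y by simp
    moreover have "- ln y \<le> ln (norm p)" using p y by (simp flip: ln_inverse add: inverse_eq_divide)
    ultimately show "\<bar>Re (Ln p)\<bar> \<le> ln y" using p by simp
    show "\<bar>Im (Ln p)\<bar> \<le> pi" using mpi_less_Im_Ln[OF p] Im_Ln_le_pi[OF p] by simp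
  qed
  finally have "norm (z * Ln p) \<le> M * (ln y + pi)"
    using z by (simp add: norm_mult mult_mono)
  then have "norm (p powr z) \<le> exp (M * (ln y + pi))"
    using p norm_exp[of "z * Ln p"] by (simp add: powr_def order_trans)
  also have "\<dots> = exp (M * pi) * y ^ M"
    using y by (simp add: distrib_left exp_add exp_of_nat_mult)
  finally show ?thesis .
qed

text \<open>With nonnegative coefficients, \<open>form_pos\<close> (positivity at the point (1, ...,
  1)) says that no form vanishes identically.\<close>

locale affine_forms =
  fixes V :: "'n::finite set" and c :: "'t::finite \<Rightarrow> real" and e :: "'t \<Rightarrow> 'n \<Rightarrow> real"
  assumes c_nonneg: "c t \<ge> 0" and e_nonneg: "i \<in> V \<Longrightarrow> e t i \<ge> 0"
    and form_pos: "c t + (\<Sum>i\<in>V. e t i) > 0"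
begin

text \<open>The variables are complex so that Cauchy's estimates apply in the summation
  variables.\<close>

definition form :: "'t \<Rightarrow> ('n \<Rightarrow> complex) \<Rightarrow> complex" where
  "form t w = of_real (c t) + (\<Sum>i\<in>V. of_real (e t i) * w i)"

definition form_powr :: "complex ^ 't \<Rightarrow> ('n \<Rightarrow> complex) \<Rightarrow> complex" where
  "form_powr s w = (\<Prod>t\<in>UNIV. form t w powr (- (s $ t)))"

text \<open>On this product of half planes the forms keep away from 0 and from the branch cut of
  \<open>powr\<close>.\<close>

lemma Re_form_ge:
  assumes "\<forall>i\<in>V. Re (w i) > 1/2"
  shows "Re (form t w) \<ge> (c t + (\<Sum>i\<in>V. e t i)) / 2"
proof -
  have "(\<Sum>i\<in>V. e t i * (1/2)) \<le> (\<Sum>i\<in>V. e t i * Re (w i))"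
    using assms e_nonneg by (intro sum_mono mult_left_mono) (auto simp: less_imp_le)
  then show ?thesis using c_nonneg[of t] by (simp add: form_def sum_divide_distrib add_divide_distrib)
qed

text \<open>Each \<open>m i\<close> is at most the product of all of them. A bound by that product
  splits over the coordinates, as the decay from the differences does.\<close>

lemma norm_form_le:
  assumes w: "\<forall>i\<in>V. norm (w i) < 2 * real (m i)" and m: "\<forall>i\<in>V. 1 \<le> m i"
  shows "norm (form t w) \<le> (c t + (\<Sum>i\<in>V. e t i)) * 2 * (\<Prod>i\<in>V. real (m i))"
proof -
  let ?p = "\<Prod>i\<in>V. real (m i)"
  have p1: "1 \<le> ?p" using m by (intro prod_ge_1) auto
  have mp: "real (m i) \<le> ?p" if "i \<in> V" for i
  proof -
    have "1 \<le> (\<Prod>i\<in>V - {i}. real (m i))" using m by (intro prod_ge_1) auto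
    then show ?thesis using that m by (subst prod.remove[of V i]) auto
  qed
  have "norm (form t w) \<le> c t + (\<Sum>i\<in>V. norm (of_real (e t i) * w i))"
    unfolding form_def using c_nonneg[of t]
    by (intro order_trans[OF norm_triangle_ineq] add_mono) (auto intro: norm_sum)
  also have "\<dots> \<le> c t * (2 * ?p) + (\<Sum>i\<in>V. e t i * (2 * ?p))"
  proof (intro add_mono sum_mono)
    show "c t \<le> c t * (2 * ?p)" using c_nonneg[of t] p1 by (simp add: mult_le_cancel_left1)
    fix i assume i: "i \<in> V"
    have "norm (w i) \<le> 2 * ?p" using w i mp[OF i] by (smt (verit))
    then show "norm (of_real (e t i) * w i) \<le> e t i * (2 * ?p)"
      using e_nonneg[OF i, of t] by (simp add: norm_mult mult_left_mono)
  qed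
  also have "\<dots> = (c t + (\<Sum>i\<in>V. e t i)) * 2 * ?p"
    by (simp add: sum_distrib_right sum_distrib_left algebra_simps)
  finally show ?thesis .
qed

lemma form_powr_bound:
  obtains C D where "C \<ge> 0"
    "\<And>s w m. norm s \<le> real M \<Longrightarrow>
      \<forall>i\<in>V. 1 \<le> m i \<and> Re (w i) > 1/2 \<and> norm (w i) < 2 * real (m i) \<Longrightarrow>
      norm (form_powr s w) \<le> C * (\<Prod>i\<in>V. real (m i)) ^ D"
proof -
  define a where "a t = c t + (\<Sum>i\<in>V. e t i)" for t
  \<comment> \<open>The constant is chosen so that \<open>b t\<close> times the product of the
    \<open>m i\<close> bounds both the norm of the form and its inverse.\<close>
  define b where "b t = max 1 (max (2 / a t) (a t * 2))" for t
  define C where "C t = exp (M * pi) * b t ^ M" for t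
  have b: "1 \<le> b t" "2 / a t \<le> b t" "a t * 2 \<le> b t" for t by (auto simp: b_def)
  have a: "0 < a t" for t using form_pos by (simp add: a_def)
  show ?thesis
  proof (rule that[of "\<Prod>t\<in>UNIV. C t" "M * CARD('t)"])
    show "0 \<le> (\<Prod>t\<in>UNIV. C t)" using b by (intro prod_nonneg) (smt (verit) C_def exp_ge_zero mult_nonneg_nonneg zero_le_power)
    fix s :: "complex ^ 't" and w :: "'n \<Rightarrow> complex" and m :: "'n \<Rightarrow> nat"
    assume s: "norm s \<le> real M"
      and m: "\<forall>i\<in>V. 1 \<le> m i \<and> Re (w i) > 1/2 \<and> norm (w i) < 2 * real (m i)"
    let ?p = "\<Prod>i\<in>V. real (m i)"
    have p1: "1 \<le> ?p" using m by (intro prod_ge_1) auto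
    have "norm (form t w powr (- (s $ t))) \<le> C t * ?p ^ M" for t
    proof -
      have "norm (- (s $ t)) \<le> real M" using s Finite_Cartesian_Product.norm_nth_le[of s] by (auto intro: order_trans)
      moreover have "1 / (b t * ?p) \<le> norm (form t w)"
      proof -
        have "1 / (b t * ?p) \<le> 1 / b t"
          using b(1)[of t] p1 by (intro divide_left_mono) (auto simp: mult_le_cancel_left1 intro!: mult_pos_pos)
        also have "\<dots> \<le> a t / 2" using b(1)[of t] b(2)[of t] a[of t] by (simp add: field_simps)
        also have "\<dots> \<le> Re (form t w)" using Re_form_ge m unfolding a_def by blast
        finally show ?thesis using complex_Re_le_cmod order_trans by blast
      qed
      moreover have "norm (form t w) \<le> b t * ?p"
        using norm_form_le[of w m t] m b(3)[of t] p1 unfolding a_def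
        by (smt (verit) mult_right_mono)
      moreover have "1 \<le> b t * ?p" using b(1)[of t] p1 by (simp add: mult_ge1_I)
      ultimately have "norm (form t w powr (- (s $ t))) \<le> exp (M * pi) * (b t * ?p) ^ M"
        by (rule norm_powr_le)
      then show ?thesis by (simp add: C_def power_mult_distrib mult_ac)
    qed
    then have "norm (form_powr s w) \<le> (\<Prod>t\<in>(UNIV::'t set). C t * ?p ^ M)"
      unfolding form_powr_def prod_norm[symmetric] by (intro prod_mono) auto
    then show "norm (form_powr s w) \<le> (\<Prod>t\<in>UNIV. C t) * ?p ^ (M * CARD('t))"
      by (simp add: prod.distrib power_mult)
  qed
qed

lemma form_powr_holomorphic:
  assumes w: "\<forall>i\<in>V. Re (w i) > 1/2"
  shows "(\<lambda>z. form_powr s (w(n := z))) holomorphic_on {z. Re z > 1/2}"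
proof -
  have h: "(\<lambda>z. form t (w(n := z))) holomorphic_on {z. Re z > 1/2}" for t
  proof -
    have "(\<lambda>z. (w(n := z)) i) holomorphic_on {z. Re z > 1/2}" for i
      by (cases "i = n") (auto intro: holomorphic_intros)
    then show ?thesis unfolding form_def by (intro holomorphic_intros)
  qed
  have "form t (w(n := z)) \<notin> \<real>\<^sub>\<le>\<^sub>0" if "Re z > 1/2" for t z
  proof -
    have "Re (form t (w(n := z))) > 0"
    proof -
      have "\<forall>i\<in>V. Re ((w(n := z)) i) > 1/2" using w that by simp
      moreover have "0 < (c t + (\<Sum>i\<in>V. e t i)) / 2" using form_pos[of t] by simp
      ultimately show ?thesis using Re_form_ge less_le_trans by blast
    qed
    then show ?thesis by (simp add: complex_nonpos_Reals_iff)
  qed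
  then show ?thesis unfolding form_powr_def
    by (intro holomorphic_on_prod holomorphic_on_powr h) auto
qed

lemma entire_form_powr: "entire (\<lambda>s. form_powr s w)"
  unfolding form_powr_def by (intro entire_prod entire_powr)

text \<open>One pair \<open>K\<close>, \<open>C\<close> serves the whole unit ball about
  \<open>s0\<close>, since the growth exponent of \<open>form_powr_bound\<close> depends only on a
  bound for \<open>norm s\<close>.\<close>

lemma bdiffs_form_powr_bound:
  fixes s0 :: "complex ^ 't"
  assumes ns: "distinct ns" "set ns = V"
  obtains K C where "\<And>s m. s \<in> ball s0 1 \<Longrightarrow> m \<in> V \<rightarrow>\<^sub>E {1..} \<Longrightarrow>
    norm (bdiffs K ns (\<lambda>m. form_powr s (\<lambda>i. of_nat (m i))) m) \<le> C * (\<Prod>n\<in>V. 1 / real (m n) ^ 2)"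
proof -
  obtain M where M: "norm s0 + 1 \<le> real M" using real_arch_simple by blast
  obtain C D where C: "C \<ge> 0" and bnd: "\<And>s w m. norm s \<le> real M \<Longrightarrow>
      \<forall>i\<in>V. 1 \<le> m i \<and> Re (w i) > 1/2 \<and> norm (w i) < 2 * real (m i) \<Longrightarrow>
      norm (form_powr s w) \<le> C * (\<Prod>i\<in>V. real (m i)) ^ D"
    using form_powr_bound[of M] by blast
  \<comment> \<open>Of the decay \<open>K\<close> in each variable, \<open>D\<close> compensates the
    growth of the summand and 2 is left for summability.\<close>
  define K where "K = D + 2"
  show ?thesis
  proof (rule that[of K "C * (\<Prod>n\<in>V. (16 * real K) ^ K)"])
    fix s m assume s: "s \<in> ball s0 1" and m: "m \<in> V \<rightarrow>\<^sub>E {1::nat..}"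
    have m1: "\<forall>i\<in>V. 1 \<le> m i" using m by auto
    have "norm s \<le> real M"
      using s M norm_triangle_ineq4[of s0 "s0 - s"] by (simp add: dist_norm)
    then have "norm (bdiffs K ns (\<lambda>m. form_powr s (\<lambda>i. of_nat (m i))) m)
        \<le> C * (\<Prod>i\<in>V. real (m i)) ^ D * (\<Prod>n\<in>set ns. (16 * real K) ^ K / real (m n) ^ K)"
      using form_powr_holomorphic[of _ s] bnd m1 ns(1)
      by (intro bdiffs_holomorphic_bound) (simp_all only: ns(2), auto)
    also have "\<dots> = C * (\<Prod>n\<in>V. (16 * real K) ^ K) * (\<Prod>n\<in>V. 1 / real (m n) ^ 2)"
    proof -
      have "real (m n) ^ D * ((16 * real K) ^ K / real (m n) ^ K) = (16 * real K) ^ K * (1 / real (m n) ^ 2)"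
        if "n \<in> V" for n using m1 that by (simp add: K_def power_add power2_eq_square)
      then have "(\<Prod>n\<in>V. real (m n) ^ D * ((16 * real K) ^ K / real (m n) ^ K))
        = (\<Prod>n\<in>V. (16 * real K) ^ K * (1 / real (m n) ^ 2))" by (intro prod.cong) auto
      then have "(\<Prod>i\<in>V. real (m i)) ^ D * (\<Prod>n\<in>V. (16 * real K) ^ K / real (m n) ^ K)
        = (\<Prod>n\<in>V. (16 * real K) ^ K) * (\<Prod>n\<in>V. 1 / real (m n) ^ 2)"
        by (simp only: prod.distrib prod_power_distrib)
      then show ?thesis by (simp only: ns mult.assoc)
    qed
    finally show "norm (bdiffs K ns (\<lambda>m. form_powr s (\<lambda>i. of_nat (m i))) m)
      \<le> C * (\<Prod>n\<in>V. (16 * real K) ^ K) * (\<Prod>n\<in>V. 1 / real (m n) ^ 2)" .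
  qed
qed

lemma form_of_nat: "form t (\<lambda>i. of_nat (m i)) = of_real (c t + (\<Sum>i\<in>V. e t i * real (m i)))"
  by (simp add: form_def)

lemma form_real_ge:
  assumes "\<forall>i\<in>V. 1 \<le> m i"
  shows "c t + (\<Sum>i\<in>V. e t i) \<le> c t + (\<Sum>i\<in>V. e t i * real (m i))"
proof (intro add_left_mono sum_mono)
  fix i assume "i \<in> V"
  then show "e t i \<le> e t i * real (m i)"
    using assms e_nonneg[of i t] by (auto simp: mult_le_cancel_left1)
qed

text \<open>After division by \<open>\<epsilon>\<close> all forms are at least 1, so their product
  \<open>y\<close> dominates each of them. Every variable \<open>n\<close> occurs in some form,
  hence \<open>y\<close> also dominates a multiple of \<open>m n\<close>, and a sufficiently
  negative power of \<open>y\<close> yields an inverse square for each variable.\<close>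

lemma form_powr_summable:
  assumes dep: "\<And>n. n \<in> V \<Longrightarrow> \<exists>t. e t n \<noteq> 0"
    and \<mu>: "\<And>n. norm (\<mu> n) = 1" and s: "\<forall>t. Re (s $ t) > 2 * real (card V)"
  shows "(\<lambda>m. (\<Prod>n\<in>V. \<mu> n ^ m n) * form_powr s (\<lambda>i. of_nat (m i))) summable_on (V \<rightarrow>\<^sub>E {1..})"
proof -
  define p where "p t m = c t + (\<Sum>i\<in>V. e t i * real (m i))" for t and m :: "'n \<Rightarrow> nat"
  \<comment> \<open>Including 1 gives \<open>\<epsilon> \<le> 1\<close>, so dividing by
    \<open>\<epsilon>\<close> does not decrease a form.\<close>
  define \<epsilon> where "\<epsilon> = Min (insert 1 (range (\<lambda>t. c t + (\<Sum>i\<in>V. e t i))))"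
  have \<epsilon>: "0 < \<epsilon>" "\<epsilon> \<le> 1" "\<epsilon> \<le> c t + (\<Sum>i\<in>V. e t i)" for t
  proof -
    show "0 < \<epsilon>" "\<epsilon> \<le> 1" unfolding \<epsilon>_def using form_pos by auto
    show "\<epsilon> \<le> c t + (\<Sum>i\<in>V. e t i)" unfolding \<epsilon>_def by (rule Min_le) auto
  qed
  obtain d where d: "\<And>n. n \<in> V \<Longrightarrow> e (d n) n \<noteq> 0" using dep by metis
  define b where "b n = e (d n) n" for n
  have b: "0 < b n" if "n \<in> V" for n using d[OF that] e_nonneg[OF that, of "d n"] by (simp add: b_def)
  define C where "C = (\<Prod>t\<in>UNIV. \<epsilon> powr (- Re (s $ t))) * (\<Prod>n\<in>V. 1 / b n ^ 2)"
  have bound: "norm ((\<Prod>n\<in>V. \<mu> n ^ m n) * form_powr s (\<lambda>i. of_nat (m i)))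
      \<le> C * (\<Prod>n\<in>V. 1 / real (m n) ^ 2)" if m: "m \<in> V \<rightarrow>\<^sub>E {1..}" for m
  proof -
    have m1: "\<forall>i\<in>V. 1 \<le> m i" using m by auto
    have p\<epsilon>: "1 \<le> p t m / \<epsilon>" for t
      using form_real_ge[OF m1, of t] \<epsilon>(1) \<epsilon>(3)[of t] by (simp add: p_def)
    have p0: "0 < p t m" for t using p\<epsilon>[of t] \<epsilon>(1) by (simp add: field_simps) 
    define y where "y = (\<Prod>t\<in>UNIV. p t m / \<epsilon>)"
    have yb: "b n * real (m n) \<le> y" if n: "n \<in> V" for n
    proof -
      have "e (d n) n * real (m n) \<le> (\<Sum>i\<in>V. e (d n) i * real (m i))"
        using n by (intro member_le_sum) (auto simp: e_nonneg)
      then have "b n * real (m n) \<le> p (d n) m" using c_nonneg[of "d n"] by (simp add: p_def b_def)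
      also have "\<dots> \<le> p (d n) m / \<epsilon>"
        using p0[of "d n"] \<epsilon> by (simp add: field_simps)
      also have "\<dots> \<le> y"
      proof -
        have "1 \<le> (\<Prod>t\<in>UNIV - {d n}. p t m / \<epsilon>)" using p\<epsilon> by (intro prod_ge_1) auto
        then have "p (d n) m / \<epsilon> * 1 \<le> p (d n) m / \<epsilon> * (\<Prod>t\<in>UNIV - {d n}. p t m / \<epsilon>)"
          using p\<epsilon>[of "d n"] by (intro mult_left_mono) auto
        also have "\<dots> = y" unfolding y_def by (rule prod.remove[symmetric]) auto
        finally show ?thesis by simp
      qed
      finally show ?thesis .
    qed
    have y1: "1 \<le> y" unfolding y_def using p\<epsilon> by (intro prod_ge_1) auto
    have "norm ((\<Prod>n\<in>V. \<mu> n ^ m n) * form_powr s (\<lambda>i. of_nat (m i)))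
        = (\<Prod>t\<in>UNIV. p t m powr (- Re (s $ t)))"
    proof -
      have "norm (form t (\<lambda>i. of_nat (m i)) powr (- (s $ t))) = p t m powr (- Re (s $ t))" for t
        using p0[of t] by (simp add: form_of_nat p_def norm_powr_real_powr)
      then show ?thesis
        by (simp add: norm_mult form_powr_def prod_norm[symmetric] norm_power \<mu>)
    qed
    also have "\<dots> \<le> (\<Prod>t\<in>UNIV. \<epsilon> powr (- Re (s $ t)) * (p t m / \<epsilon>) powr (- (2 * real (card V))))"
    proof (intro prod_mono conjI)
      fix t
      have "p t m powr (- Re (s $ t)) = \<epsilon> powr (- Re (s $ t)) * (p t m / \<epsilon>) powr (- Re (s $ t))"
        using p0[of t] \<epsilon>(1) by (simp add: powr_mult[symmetric])
      also have "(p t m / \<epsilon>) powr (- Re (s $ t)) \<le> (p t m / \<epsilon>) powr (- (2 * real (card V)))"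
        using p\<epsilon>[of t] s by (intro powr_mono) (auto simp: less_imp_le)
      finally show "p t m powr (- Re (s $ t)) \<le>
          \<epsilon> powr (- Re (s $ t)) * (p t m / \<epsilon>) powr (- (2 * real (card V)))"
        by (simp add: mult_left_mono)
    qed simp
    also have "\<dots> = (\<Prod>t\<in>UNIV. \<epsilon> powr (- Re (s $ t))) * y powr (- (2 * real (card V)))"
      unfolding y_def prod.distrib using p\<epsilon>
      by (subst prod_powr_distrib) (auto intro: order_trans[OF zero_le_one])
    \<comment> \<open>The exponent \<open>2 * card V\<close> is dealt out as one factor
      \<open>1 / y ^ 2\<close> for each variable in \<open>V\<close>.\<close>
    also have "y powr (- (2 * real (card V))) = (\<Prod>n\<in>V. 1 / y ^ 2)"
    proof -
      have "y powr (- (2 * real (card V))) = inverse (y powr real (2 * card V))"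
        unfolding powr_minus by simp
      also have "\<dots> = inverse (y ^ (2 * card V))" using y1 by (subst powr_realpow) auto
      also have "\<dots> = (\<Prod>n\<in>V. 1 / y ^ 2)"
        by (simp only: prod_constant power_mult power_one_over inverse_eq_divide)
      finally show ?thesis .
    qed
    also have "\<dots> \<le> (\<Prod>n\<in>V. 1 / (b n * real (m n)) ^ 2)"
      using yb b m1 y1 by (intro prod_mono conjI divide_left_mono power_mono mult_pos_pos zero_less_power)
        (auto simp: less_imp_le Suc_le_eq)
    finally show ?thesis
      by (simp add: C_def power_mult_distrib prod_dividef prod.distrib mult_left_mono prod_nonneg)
  qed
  show ?thesis
    by (rule abs_summable_summable, rule Infinite_Sum.abs_summable_on_comparison_test'[OF
          summable_on_cmult_right[OF summable_on_prod_inverse_squares]]) (use bound in auto)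
qed

text \<open>\<open>F s\<close> is the regularised sum at \<open>s\<close>. Near any point one fixed
  \<open>K\<close> represents it by a locally dominated series of entire functions; uniqueness makes
  the local representations agree with the single function \<open>F\<close>.\<close>

lemma exists_continuation:
  assumes dep: "\<And>n. n \<in> V \<Longrightarrow> \<exists>t. e t n \<noteq> 0"
    and \<mu>: "\<And>n. norm (\<mu> n) = 1" "\<And>n. \<mu> n \<noteq> 1" and ns: "distinct ns" "set ns = V"
  obtains F where
    "is_continuation (\<lambda>s m. (\<Prod>n\<in>V. \<mu> n ^ m n) * form_powr s (\<lambda>i. of_nat (m i))) (V \<rightarrow>\<^sub>E {1..}) F"
    "\<And>s. reg_sum ns \<mu> (\<lambda>m. form_powr s (\<lambda>i. of_nat (m i))) (F s)"
proof -
  define f where "f s m = form_powr s (\<lambda>i. of_nat (m i))" for s and m :: "'n \<Rightarrow> nat"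
  define F where "F s = (THE X. reg_sum ns \<mu> (f s) X)" for s
  have FI: "F s = X" if "reg_sum ns \<mu> (f s) X" for s X
    unfolding F_def using that reg_sum_unique[of ns \<mu>, OF ns(1) \<mu>(2)] by (intro the_equality)
  let ?A = "V \<rightarrow>\<^sub>E {1::nat..}"
  let ?c = "\<Prod>n\<in>V. 1 - \<mu> n"
  have c0: "?c \<noteq> 0" using \<mu>(2) by simp
  \<comment> \<open>Everything is proved near a given \<open>s0\<close>, because the required order
    \<open>K\<close> varies with \<open>s0\<close>.\<close>
  have loc: "(\<exists>D. (F has_derivative D) (at s0) \<and> (\<forall>c v. D (c *s v) = c * D v)) \<and>
      reg_sum ns \<mu> (f s0) (F s0)" for s0
  proof -
    obtain K C where bnd: "\<And>s m. s \<in> ball s0 1 \<Longrightarrow> m \<in> ?A \<Longrightarrow>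
        norm (bdiffs K ns (f s) m) \<le> C * (\<Prod>n\<in>V. 1 / real (m n) ^ 2)"
      using bdiffs_form_powr_bound[OF ns, of s0] unfolding f_def by blast
    define G where "G m s = (\<Prod>n\<in>V. \<mu> n ^ m n) * bdiffs K ns (f s) m" for m s
    have S: "(\<lambda>m. C * (\<Prod>n\<in>V. 1 / real (m n) ^ 2)) summable_on ?A"
      by (rule summable_on_cmult_right[OF summable_on_prod_inverse_squares]) simp
    have Gb: "norm (G m s) \<le> C * (\<Prod>n\<in>V. 1 / real (m n) ^ 2)" if "m \<in> ?A" "s \<in> ball s0 1" for m s
      using bnd[OF that(2,1)] by (simp add: G_def norm_mult prod_norm[symmetric] norm_power \<mu>)
    have Gs: "(\<lambda>m. G m s) summable_on ?A" if "s \<in> ball s0 1" for s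
      by (rule abs_summable_summable, rule Infinite_Sum.abs_summable_on_comparison_test'[OF S])
        (use Gb that in auto)
    have reg: "reg_sum ns \<mu> (f s) (inverse (?c ^ K) * (\<Sum>\<^sub>\<infinity>m\<in>?A. G m s))" if "s \<in> ball s0 1" for s
    proof -
      have "((\<lambda>m. G m s) has_sum ?c ^ K * (inverse (?c ^ K) * (\<Sum>\<^sub>\<infinity>m\<in>?A. G m s))) ?A"
      proof -
        have "?c ^ K * (inverse (?c ^ K) * x) = x" for x
          using c0 by (metis mult.assoc mult_1 power_not_zero right_inverse)
        then show ?thesis using has_sum_infsum[OF Gs[OF that]] by (simp only:)
      qed
      then show ?thesis unfolding reg_sum_def G_def ns(2) by blast
    qed
    have Ge: "entire (G m)" if "m \<in> ?A" for m
      unfolding G_def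
    proof (rule entire_mult[OF entire_const])
      show "entire (\<lambda>s. bdiffs K ns (f s) m)"
        by (rule bdiffs_closed[where Q = entire and V = V and F = f])
          (use that in \<open>auto intro: entire_diff simp: f_def entire_form_powr\<close>)
    qed
    obtain D where D: "((\<lambda>s. \<Sum>\<^sub>\<infinity>m\<in>?A. G m s) has_derivative D) (at s0)"
      "\<And>c v. D (c *s v) = c * D v"
      using infsum_entire_has_derivative[OF Ge zero_less_one Gb S] by blast
    have "((\<lambda>s. inverse (?c ^ K) * (\<Sum>\<^sub>\<infinity>m\<in>?A. G m s)) has_derivative (\<lambda>v. inverse (?c ^ K) * D v)) (at s0)"
      by (rule has_derivative_mult_right[OF D(1)])
    \<comment> \<open>By uniqueness of regularised sums, \<open>F\<close> coincides on the ball with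
      the formula for this \<open>K\<close>.\<close>
    then have "(F has_derivative (\<lambda>v. inverse (?c ^ K) * D v)) (at s0)"
      by (rule has_derivative_transform_within_open[of _ _ _ _ "ball s0 1"]) (auto simp: FI[OF reg])
    then have "\<exists>D. (F has_derivative D) (at s0) \<and> (\<forall>c v. D (c *s v) = c * D v)"
      using D(2) by (intro exI[of _ "\<lambda>v. inverse (?c ^ K) * D v"]) simp
    moreover have "reg_sum ns \<mu> (f s0) (F s0)" using FI[OF reg, of s0] reg[of s0] by simp
    ultimately show ?thesis by blast
  qed
  have "is_continuation (\<lambda>s m. (\<Prod>n\<in>V. \<mu> n ^ m n) * f s m) ?A F"
    unfolding is_continuation_def
  proof (intro conjI exI[of _ "2 * real (card V)"] allI impI)
    show "entire F" unfolding entire_def using loc by blast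
    fix s :: "complex ^ 't" assume s: "\<forall>t. 2 * real (card V) < Re (s $ t)"
    have h: "((\<lambda>m. (\<Prod>n\<in>V. \<mu> n ^ m n) * f s m) has_sum
        (\<Sum>\<^sub>\<infinity>m\<in>?A. (\<Prod>n\<in>V. \<mu> n ^ m n) * f s m)) ?A"
      unfolding f_def by (rule has_sum_infsum[OF form_powr_summable[OF dep \<mu>(1) s]])
    \<comment> \<open>A convergent sum is a regularised sum of order 0.\<close>
    then have "reg_sum ns \<mu> (f s) (\<Sum>\<^sub>\<infinity>m\<in>?A. (\<Prod>n\<in>V. \<mu> n ^ m n) * f s m)"
      unfolding reg_sum_def by (intro exI[of _ 0]) (simp add: bdiffs_0 ns)
    with h show "((\<lambda>m. (\<Prod>n\<in>V. \<mu> n ^ m n) * f s m) has_sum F s) ?A" by (simp add: FI)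
  qed
  then show ?thesis using that loc unfolding f_def by blast
qed

end

section \<open>Continuation of zeta series of affine forms\<close>

text \<open>The second conclusion describes the continued value at every \<open>s\<close> by a
  relation linear in the summand; this gives access to values outside the region of
  convergence.\<close>

lemma is_continuation_zeta:
  fixes P :: "'t::finite \<Rightarrow> ('n::finite \<Rightarrow> nat) \<Rightarrow> real"
  assumes \<mu>: "\<And>n. norm (\<mu> n) = 1" "\<And>n. \<mu> n \<noteq> 1"
    and P: "\<And>t d. P t d = c t + (\<Sum>i\<in>V. e t i * real (d i))"
    and nonneg: "\<And>t. c t \<ge> 0" "\<And>t i. e t i \<ge> 0"
    and dep: "\<And>n. n \<in> V \<Longrightarrow> \<exists>t. e t n \<noteq> 0"
    and nz: "\<And>t. P t \<noteq> (\<lambda>_. 0)"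
    and ns: "distinct ns" "set ns = V"
  shows "is_continuation (zeta_term V (\<lambda>_. 1) P \<mu>) (V \<rightarrow>\<^sub>E {1..}) (zeta V (\<lambda>_. 1) P \<mu>)"
    and "reg_sum ns \<mu> (\<lambda>m. \<Prod>t\<in>UNIV. of_real (P t m) powr (- (s $ t))) (zeta V (\<lambda>_. 1) P \<mu> s)"
proof -
  interpret affine_forms V c e
  proof
    fix t
    have "0 \<le> c t + (\<Sum>i\<in>V. e t i)" using nonneg by (intro add_nonneg_nonneg sum_nonneg) auto
    moreover have "c t + (\<Sum>i\<in>V. e t i) \<noteq> 0"
    proof
      assume "c t + (\<Sum>i\<in>V. e t i) = 0"
      then have "c t = 0 \<and> (\<Sum>i\<in>V. e t i) = 0"
        using nonneg by (subst (asm) add_nonneg_eq_0_iff) (auto intro: sum_nonneg)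
      then have "c t = 0" "\<forall>i\<in>V. e t i = 0"
        using nonneg by (auto simp: sum_nonneg_eq_0_iff)
      then have "P t = (\<lambda>_. 0)" by (auto simp: P)
      then show False using nz by blast
    qed
    ultimately show "0 < c t + (\<Sum>i\<in>V. e t i)" by simp
  qed (use nonneg in auto)
  have fp: "form_powr s (\<lambda>i. of_nat (m i)) = (\<Prod>t\<in>UNIV. of_real (P t m) powr (- (s $ t)))" for s m
    by (simp add: form_powr_def form_of_nat P)
  obtain F where F: "is_continuation (zeta_term V (\<lambda>_. 1) P \<mu>) (V \<rightarrow>\<^sub>E {1..}) F"
    "\<And>s. reg_sum ns \<mu> (\<lambda>m. form_powr s (\<lambda>i. of_nat (m i))) (F s)"
    using exists_continuation[of \<mu> ns, OF dep \<mu> ns] unfolding fp zeta_term_def by auto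
  have "zeta V (\<lambda>_. 1) P \<mu> = F" unfolding zeta_def using F(1) by (rule continuation_eqI)
  then show "is_continuation (zeta_term V (\<lambda>_. 1) P \<mu>) (V \<rightarrow>\<^sub>E {1..}) (zeta V (\<lambda>_. 1) P \<mu>)"
    "reg_sum ns \<mu> (\<lambda>m. \<Prod>t\<in>UNIV. of_real (P t m) powr (- (s $ t))) (zeta V (\<lambda>_. 1) P \<mu> s)"
    using F fp by simp_all
qed

text \<open>A form may vanish identically. As \<open>0 powr z = 0\<close> for all \<open>z\<close>, even \<open>z = 0\<close>, the series is then
  zero at every \<open>s\<close>.\<close>

lemma zeta_term_zero_form:
  fixes P :: "'t::finite \<Rightarrow> ('n::finite \<Rightarrow> nat) \<Rightarrow> real"
  assumes "P t = (\<lambda>_. 0)"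
  shows "zeta_term V Q P \<mu> s m = 0"
  unfolding zeta_term_def using assms by (auto intro!: prod_zero exI[of _ t])

lemma zeta_zero_form:
  fixes P :: "'t::finite \<Rightarrow> ('n::finite \<Rightarrow> nat) \<Rightarrow> real"
  assumes "P t = (\<lambda>_. 0)"
  shows "is_continuation (zeta_term V Q P \<mu>) A (\<lambda>_. 0)" "zeta V Q P \<mu> s = 0"
proof -
  have "zeta_term V Q P \<mu> = (\<lambda>s m. 0)" by (intro ext zeta_term_zero_form[where P = P, OF assms])
  then show *: "is_continuation (zeta_term V Q P \<mu>) A (\<lambda>_. 0)" for A
    by (simp add: is_continuation_def entire_const)
  show "zeta V Q P \<mu> s = 0" unfolding zeta_def continuation_eqI[OF *] by simp
qed

section \<open>Decomposition of the series\<close>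

lemma restrict_fun_affine:
  fixes P :: "('n::finite \<Rightarrow> nat) \<Rightarrow> real"
  assumes P: "\<And>m. P m = (\<Sum>i\<in>UNIV. e i * real (m i))"
  shows "restrict_fun a I b P d =
    ((\<Sum>i\<in>I. e i * real (a i)) + (\<Sum>i\<in>-I. e i * real (b i))) + (\<Sum>i\<in>I. e i * real (d i))"
proof -
  have "restrict_fun a I b P d = (\<Sum>i\<in>I \<union> -I. e i * real (if i \<in> I then a i + d i else b i))"
    by (simp add: restrict_fun_def P)
  also have "\<dots> = (\<Sum>i\<in>I. e i * real (if i \<in> I then a i + d i else b i))
      + (\<Sum>i\<in>-I. e i * real (if i \<in> I then a i + d i else b i))"
    by (rule sum.union_disjoint) auto
  also have "\<dots> = (\<Sum>i\<in>I. e i * real (a i) + e i * real (d i)) + (\<Sum>i\<in>-I. e i * real (b i))"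
    by (intro arg_cong2[of _ _ _ _ "(+)"] sum.cong) (auto simp: distrib_left)
  finally show ?thesis by (simp add: sum.distrib)
qed

text \<open>Every point \<open>m\<close> with positive coordinates is \<open>glue a I b d\<close> for exactly one triple \<open>(I, b, d)\<close>:
  \<open>I\<close> consists of the indices with \<open>m i > a i\<close>.\<close>

definition glue :: "('n \<Rightarrow> nat) \<Rightarrow> 'n set \<Rightarrow> ('n \<Rightarrow> nat) \<Rightarrow> ('n \<Rightarrow> nat) \<Rightarrow> 'n \<Rightarrow> nat" where
  "glue a I b d = (\<lambda>i. if i \<in> I then a i + d i else b i)"

text \<open>\<open>I\<close> can be read off the point: \<open>d i \<ge> 1\<close> lifts coordinates
  in \<open>I\<close> above \<open>a i\<close>, whereas \<open>b i \<le> a i\<close> elsewhere.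
  Extensionality fixes \<open>b\<close> and \<open>d\<close> outside their domains.\<close>

lemma glue_eqD:
  assumes eq: "glue a I b d = glue a J b' d'"
    and b: "b \<in> (\<Pi>\<^sub>E i\<in>-I. {1..a i})" "b' \<in> (\<Pi>\<^sub>E i\<in>-J. {1..a i})"
    and d: "d \<in> I \<rightarrow>\<^sub>E {1..}" "d' \<in> J \<rightarrow>\<^sub>E {1..}"
  shows "I = J \<and> b = b' \<and> d = d'"
proof -
  have large: "i \<in> K \<longleftrightarrow> glue a K c x i > a i"
    if "c \<in> (\<Pi>\<^sub>E i\<in>-K. {1..a i})" "x \<in> K \<rightarrow>\<^sub>E {1..}" for i K c x
  proof (cases "i \<in> K")
    case True
    then show ?thesis using PiE_mem[OF that(2) True] by (simp add: glue_def)
  next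
    case False
    then show ?thesis using PiE_mem[OF that(1), of i] by (simp add: glue_def)
  qed
  have IJ: "I = J" using large[OF b(1) d(1)] large[OF b(2) d(2)] eq by auto
  have "b i = b' i" for i
  proof (cases "i \<in> I")
    case True
    then show ?thesis using b IJ by (auto simp: PiE_iff extensional_def)
  next
    case False
    then show ?thesis using fun_cong[OF eq, of i] IJ by (simp add: glue_def)
  qed
  moreover have "d i = d' i" for i
  proof (cases "i \<in> I")
    case True
    then show ?thesis using fun_cong[OF eq, of i] IJ by (simp add: glue_def)
  next
    case False
    then show ?thesis using d IJ by (auto simp: PiE_iff extensional_def)
  qed
  ultimately show ?thesis using IJ by auto
qed

lemma glue_cover:
  fixes m a :: "'n \<Rightarrow> nat"
  assumes "\<And>n. 1 \<le> m n"
  defines "I \<equiv> {n. m n > a n}"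
  obtains b d where "b \<in> (\<Pi>\<^sub>E i\<in>-I. {1..a i})" "d \<in> I \<rightarrow>\<^sub>E {1..}" "m = glue a I b d"
proof
  show "restrict m (-I) \<in> (\<Pi>\<^sub>E i\<in>-I. {1..a i})" using assms by (auto simp: I_def)
  show "(\<lambda>i\<in>I. m i - a i) \<in> I \<rightarrow>\<^sub>E {1..}" by (auto simp: I_def)
  show "m = glue a I (restrict m (-I)) (\<lambda>i\<in>I. m i - a i)" by (auto simp: glue_def I_def)
qed

lemma glue_pos:
  assumes "b \<in> (\<Pi>\<^sub>E i\<in>-I. {1..a i})" "d \<in> I \<rightarrow>\<^sub>E {1..}"
  shows "1 \<le> glue a I b d n"
  using PiE_mem[OF assms(1), of n] PiE_mem[OF assms(2), of n] by (auto simp: glue_def)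

lemma prod_if_mem_split:
  fixes f g :: "'n::finite \<Rightarrow> 'a::comm_monoid_mult"
  shows "(\<Prod>n\<in>UNIV. if n \<in> I then f n else g n) = prod f I * prod g (-I)"
  using prod.If_cases[of UNIV "\<lambda>n. n \<in> I" f g] by simp

text \<open>The factor \<open>\<mu> i ^ a i\<close> arises from \<open>m i = a i + d i\<close> on
  \<open>I\<close>; the forms see the glued point through \<open>restrict_fun\<close>.\<close>

lemma zeta_term_glue:
  "zeta_term UNIV (\<lambda>_. 1) P \<mu> s (glue a I b d) = ((\<Prod>i\<in>I. \<mu> i ^ a i) * (\<Prod>i\<in>-I. \<mu> i ^ b i)) *
     zeta_term I (\<lambda>_. 1) (\<lambda>t. restrict_fun a I b (P t)) \<mu> s d"
proof -
  have "(\<Prod>n\<in>UNIV. \<mu> n ^ glue a I b d n)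
      = (\<Prod>n\<in>UNIV. if n \<in> I then \<mu> n ^ a n * \<mu> n ^ d n else \<mu> n ^ b n)"
    by (intro prod.cong) (auto simp: glue_def power_add)
  then have "(\<Prod>n\<in>UNIV. \<mu> n ^ glue a I b d n)
      = (\<Prod>i\<in>I. \<mu> i ^ a i) * (\<Prod>i\<in>I. \<mu> i ^ d i) * (\<Prod>i\<in>-I. \<mu> i ^ b i)"
    by (simp add: prod_if_mem_split prod.distrib)
  then show ?thesis by (simp add: zeta_term_def restrict_fun_def glue_def mult_ac)
qed

lemma prod_binomial:
  fixes x y :: "'t::finite \<Rightarrow> 'a::comm_semiring_1"
  shows "(\<Prod>t\<in>UNIV. (x t + y t) ^ k t) =
    (\<Sum>u | \<forall>t. u t \<le> k t. (\<Prod>t\<in>UNIV. y t ^ (k t - u t)) * of_nat (\<Prod>t\<in>UNIV. k t choose u t) *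
      (\<Prod>t\<in>UNIV. x t ^ u t))"
proof -
  have "(\<Prod>t\<in>UNIV. (x t + y t) ^ k t) =
      (\<Prod>t\<in>UNIV. \<Sum>j\<le>k t. of_nat (k t choose j) * x t ^ j * y t ^ (k t - j))"
    by (simp add: binomial_ring)
  also have "\<dots> = (\<Sum>u\<in>(\<Pi>\<^sub>E t\<in>UNIV. {..k t}).
      \<Prod>t\<in>UNIV. of_nat (k t choose u t) * x t ^ u t * y t ^ (k t - u t))"
    by (rule prod_sum_PiE) auto
  also have "(\<Pi>\<^sub>E t\<in>UNIV. {..k t}) = {u. \<forall>t. u t \<le> k t}" by (auto simp: PiE_iff)
  finally show ?thesis by (simp add: prod.distrib mult_ac)
qed

section \<open>Cutting the series of linear forms along \<open>a\<close>\<close>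

locale linear_forms =
  fixes \<mu> :: "'n::finite \<Rightarrow> complex" and P :: "'t::finite \<Rightarrow> ('n \<Rightarrow> nat) \<Rightarrow> real"
    and l :: "'t \<Rightarrow> 'n \<Rightarrow> real" and a :: "'n \<Rightarrow> nat"
  assumes norm_\<mu>: "norm (\<mu> n) = 1" and \<mu>_neq_1: "\<mu> n \<noteq> 1"
    and P_eq: "P t m = (\<Sum>i\<in>UNIV. l t i * real (m i))" and l_nonneg: "l t i \<ge> 0"
    and l_dep: "\<exists>t. l t i \<noteq> 0"
begin

definition rzeta :: "'n set \<Rightarrow> ('n \<Rightarrow> nat) \<Rightarrow> complex ^ 't \<Rightarrow> complex" where
  "rzeta I b = zeta I (\<lambda>_. 1) (\<lambda>t. restrict_fun a I b (P t)) \<mu>"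

lemma P_pos:
  assumes m: "\<And>i. 1 \<le> m i" and nz: "P t \<noteq> (\<lambda>_. 0)"
  shows "P t m > 0"
proof -
  obtain i where i: "l t i \<noteq> 0" using nz by (force simp: P_eq)
  have "0 < l t i * real (m i)" using i l_nonneg[of t i] m[of i] by simp
  also have "\<dots> \<le> (\<Sum>i\<in>UNIV. l t i * real (m i))"
    by (rule member_le_sum) (auto intro: l_nonneg mult_nonneg_nonneg)
  finally show ?thesis by (simp add: P_eq)
qed

lemma is_continuation_rzeta:
  assumes b: "b \<in> (\<Pi>\<^sub>E i\<in>-I. {1..a i})"
  shows "is_continuation (zeta_term I (\<lambda>_. 1) (\<lambda>t. restrict_fun a I b (P t)) \<mu>) (I \<rightarrow>\<^sub>E {1..}) (rzeta I b)"
proof (cases "\<exists>t. P t = (\<lambda>_. 0)")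
  case True
  then obtain t where "P t = (\<lambda>_. 0)" by blast
  then have "restrict_fun a I b (P t) = (\<lambda>_. 0)" by (simp add: restrict_fun_def fun_eq_iff)
  note z = zeta_zero_form[where P = "\<lambda>t. restrict_fun a I b (P t)", OF this]
  have "rzeta I b = (\<lambda>_. 0)" unfolding rzeta_def by (intro ext z)
  then show ?thesis using z(1) by simp
next
  case False
  obtain ns where ns: "distinct ns" "set ns = I" using finite_distinct_list[of I] by auto
  \<comment> \<open>Gluing the constant 1 on \<open>I\<close> to \<open>b\<close> produces a
    positive point, where a nonzero form is positive.\<close>
  have nz: "restrict_fun a I b (P t) \<noteq> (\<lambda>_. 0)" for t
  proof
    assume "restrict_fun a I b (P t) = (\<lambda>_. 0)"
    then have "P t (glue a I b (restrict (\<lambda>_. 1) I)) = 0"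
      unfolding restrict_fun_def glue_def by meson
    moreover have "P t (glue a I b (restrict (\<lambda>_. 1) I)) > 0"
      using False by (intro P_pos glue_pos[OF b]) auto
    ultimately show False by simp
  qed
  show ?thesis unfolding rzeta_def
    by (rule is_continuation_zeta(1)[OF norm_\<mu> \<mu>_neq_1 restrict_fun_affine[OF P_eq] _ l_nonneg l_dep nz ns])
      (intro add_nonneg_nonneg sum_nonneg mult_nonneg_nonneg l_nonneg; simp)
qed

text \<open>The family \<open>S\<close> selects the pieces: all proper subsets give the boundary
  set, all subsets give the full index set.\<close>

lemma is_continuation_glue:
  assumes B: "B = (\<Union>(I, b)\<in>Sigma S (\<lambda>I. \<Pi>\<^sub>E i\<in>-I. {1..a i}). glue a I b ` (I \<rightarrow>\<^sub>E {1..}))"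
  shows "is_continuation (zeta_term UNIV (\<lambda>_. 1) P \<mu>) B
    (\<lambda>s. \<Sum>I\<in>S. \<Sum>b\<in>(\<Pi>\<^sub>E i\<in>-I. {1..a i}).
      (\<Prod>i\<in>I. \<mu> i ^ a i) * (\<Prod>i\<in>-I. \<mu> i ^ b i) * rzeta I b s)"
proof -
  let ?S = "Sigma S (\<lambda>I. \<Pi>\<^sub>E i\<in>-I. {1..a i})"
  have fin: "finite (\<Pi>\<^sub>E i\<in>-I. {1..a i})" for I by (intro finite_PiE) auto
  have "is_continuation (zeta_term UNIV (\<lambda>_. 1) P \<mu>) B
    (\<lambda>s. \<Sum>x\<in>?S. ((\<Prod>i\<in>fst x. \<mu> i ^ a i) * (\<Prod>i\<in>-fst x. \<mu> i ^ snd x i)) * rzeta (fst x) (snd x) s)"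
  proof (rule is_continuation_sum[where A = "\<lambda>x. fst x \<rightarrow>\<^sub>E {1..}" and h = "\<lambda>x. glue a (fst x) (snd x)"
        and f = "\<lambda>x. zeta_term (fst x) (\<lambda>_. 1) (\<lambda>t. restrict_fun a (fst x) (snd x) (P t)) \<mu>"])
    show "finite ?S" using fin by (intro finite_SigmaI) auto
    show "B = (\<Union>x\<in>?S. glue a (fst x) (snd x) ` (fst x \<rightarrow>\<^sub>E {1..}))"
      unfolding B by (simp add: case_prod_beta)
    show "glue a (fst x) (snd x) ` (fst x \<rightarrow>\<^sub>E {1..}) \<inter> glue a (fst y) (snd y) ` (fst y \<rightarrow>\<^sub>E {1..}) = {}"
      if xy: "x \<in> ?S" "y \<in> ?S" "x \<noteq> y" for x y
    proof (rule ccontr)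
      assume "\<not> ?thesis"
      then obtain d d' where "d \<in> fst x \<rightarrow>\<^sub>E {1..}" "d' \<in> fst y \<rightarrow>\<^sub>E {1..}"
        "glue a (fst x) (snd x) d = glue a (fst y) (snd y) d'" by blast
      then have "fst x = fst y \<and> snd x = snd y" using glue_eqD xy(1,2) by (metis SigmaE fst_conv snd_conv)
      then show False using xy(3) by (simp add: prod_eq_iff)
    qed
    show "inj_on (glue a (fst x) (snd x)) (fst x \<rightarrow>\<^sub>E {1..})" if "x \<in> ?S" for x
    proof -
      have "snd x \<in> (\<Pi>\<^sub>E i\<in>-fst x. {1..a i})" using that by auto
      from glue_eqD[OF _ this this] show ?thesis by (intro inj_onI) blast
    qed
    show "is_continuation (zeta_term (fst x) (\<lambda>_. 1) (\<lambda>t. restrict_fun a (fst x) (snd x) (P t)) \<mu>)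
        (fst x \<rightarrow>\<^sub>E {1..}) (rzeta (fst x) (snd x))" if "x \<in> ?S" for x
      using that is_continuation_rzeta by auto
  qed (rule zeta_term_glue)
  then show ?thesis using fin by (simp add: sum.Sigma case_prod_beta mult.assoc)
qed

lemma boundary_zeta_eq:
  "boundary_zeta a P \<mu> s = (\<Sum>I\<in>- {UNIV}. \<Sum>b\<in>(\<Pi>\<^sub>E i\<in>-I. {1..a i}).
      (\<Prod>i\<in>I. \<mu> i ^ a i) * (\<Prod>i\<in>-I. \<mu> i ^ b i) * rzeta I b s)"
proof -
  have "boundary_set a = (\<Union>(I, b)\<in>Sigma (- {UNIV}) (\<lambda>I. \<Pi>\<^sub>E i\<in>-I. {1..a i}). glue a I b ` (I \<rightarrow>\<^sub>E {1..}))"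
    (is "_ = ?B")
  proof (intro equalityI subsetI)
    fix m assume m: "m \<in> boundary_set a"
    then obtain n where n: "m n \<le> a n" and m1: "\<And>n. 1 \<le> m n" by (auto simp: boundary_set_def)
    obtain b d where bd: "b \<in> (\<Pi>\<^sub>E i\<in>-{n. m n > a n}. {1..a i})" "d \<in> {n. m n > a n} \<rightarrow>\<^sub>E {1..}"
      "m = glue a {n. m n > a n} b d" using glue_cover[OF m1] .
    moreover have "{n. m n > a n} \<noteq> UNIV" using n by (metis UNIV_I leD mem_Collect_eq)
    ultimately show "m \<in> ?B" by blast
  next
    fix m assume "m \<in> ?B"
    then obtain I b d where I: "I \<noteq> UNIV" "b \<in> (\<Pi>\<^sub>E i\<in>-I. {1..a i})" "d \<in> I \<rightarrow>\<^sub>E {1..}"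
      "m = glue a I b d" by auto
    then obtain n where "n \<notin> I" by auto
    then have "m n \<le> a n" using I PiE_mem[OF I(2), of n] by (simp add: glue_def)
    then show "m \<in> boundary_set a" using glue_pos[OF I(2,3)] I(4) by (auto simp: boundary_set_def)
  qed
  from continuation_eqI[OF is_continuation_glue[OF this]] show ?thesis
    by (simp add: boundary_zeta_def)
qed

lemma zeta_eq_sum_glue:
  "zeta UNIV (\<lambda>_. 1) P \<mu> s = (\<Sum>I\<in>UNIV. \<Sum>b\<in>(\<Pi>\<^sub>E i\<in>-I. {1..a i}).
      (\<Prod>i\<in>I. \<mu> i ^ a i) * (\<Prod>i\<in>-I. \<mu> i ^ b i) * rzeta I b s)"
proof -
  have "UNIV \<rightarrow>\<^sub>E {1..} = (\<Union>(I, b)\<in>Sigma UNIV (\<lambda>I. \<Pi>\<^sub>E i\<in>-I. {1..a i}). glue a I b ` (I \<rightarrow>\<^sub>E {1..}))"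
    (is "_ = ?B")
  proof (intro equalityI subsetI)
    fix m :: "'n \<Rightarrow> nat" assume m: "m \<in> UNIV \<rightarrow>\<^sub>E {1..}"
    have m1: "\<And>n. 1 \<le> m n" using PiE_mem[OF m] by simp
    obtain b d where "b \<in> (\<Pi>\<^sub>E i\<in>-{n. m n > a n}. {1..a i})" "d \<in> {n. m n > a n} \<rightarrow>\<^sub>E {1..}"
      "m = glue a {n. m n > a n} b d" using glue_cover[OF m1] .
    then show "m \<in> ?B" by blast
  next
    fix m assume "m \<in> ?B"
    then obtain I b d where I: "b \<in> (\<Pi>\<^sub>E i\<in>-I. {1..a i})" "d \<in> I \<rightarrow>\<^sub>E {1..}"
      "m = glue a I b d" by auto
    then show "m \<in> UNIV \<rightarrow>\<^sub>E {1..}" using glue_pos[OF I(1,2)] by (auto simp: PiE_iff)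
  qed
  from continuation_eqI[OF is_continuation_glue[OF this]] show ?thesis
    by (simp add: zeta_def)
qed

text \<open>The summand \<open>I = UNIV\<close> is split off. Its \<open>b\<close> lives on the
  empty set, whose only extensional function is \<open>\<lambda>_. undefined\<close>.\<close>

lemma zeta_eq_boundary_plus_shift:
  "zeta UNIV (\<lambda>_. 1) P \<mu> s = boundary_zeta a P \<mu> s +
    (\<Prod>i\<in>UNIV. \<mu> i ^ a i) * rzeta UNIV (\<lambda>_. undefined) s"
proof -
  have "zeta UNIV (\<lambda>_. 1) P \<mu> s = (\<Sum>I\<in>insert UNIV (- {UNIV}). \<Sum>b\<in>(\<Pi>\<^sub>E i\<in>-I. {1..a i}).
      (\<Prod>i\<in>I. \<mu> i ^ a i) * (\<Prod>i\<in>-I. \<mu> i ^ b i) * rzeta I b s)"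
    unfolding zeta_eq_sum_glue by (intro sum.cong) auto
  also have "\<dots> = (\<Sum>b\<in>(\<Pi>\<^sub>E i\<in>-UNIV. {1..a i}).
      (\<Prod>i\<in>UNIV. \<mu> i ^ a i) * (\<Prod>i\<in>-UNIV. \<mu> i ^ b i) * rzeta UNIV b s) + boundary_zeta a P \<mu> s"
    unfolding boundary_zeta_eq by (rule sum.insert) auto
  finally show ?thesis by (simp add: PiE_empty_domain Compl_UNIV_eq)
qed

section \<open>Values at negative integers\<close>

text \<open>At \<open>-k\<close> the shifted summand is the polynomial with factors
  \<open>(P t m + P t a) ^ k t\<close>. Its binomial expansion is an identity between summands,
  which linearity and uniqueness of regularised sums transfer to the continued values, where the
  series themselves need not converge.\<close>

lemma rzeta_UNIV_neg_nat:
  "rzeta UNIV (\<lambda>_. undefined) (neg_nat_vec k) =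
    (\<Sum>u | \<forall>t. u t \<le> k t. of_real (\<Prod>t\<in>UNIV. P t a ^ (k t - u t)) *
       of_nat (\<Prod>t\<in>UNIV. k t choose u t) * zeta UNIV (\<lambda>_. 1) P \<mu> (neg_nat_vec u))"
proof (cases "\<exists>t. P t = (\<lambda>_. 0)")
  case True
  then obtain t where t: "P t = (\<lambda>_. 0)" by blast
  then have "restrict_fun a UNIV b (P t) = (\<lambda>_. 0)" for b by (simp add: restrict_fun_def fun_eq_iff)
  note z = zeta_zero_form(2)[where P = "\<lambda>t. restrict_fun a UNIV _ (P t)", OF this]
  \<comment> \<open>Both sides vanish, also when all exponents are zero, by the convention
    \<open>0 powr 0 = 0\<close>.\<close>
  show ?thesis unfolding rzeta_def z zeta_zero_form(2)[where P = P, OF t] by simp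
next
  case False
  obtain ns where ns: "distinct ns" "set ns = (UNIV :: 'n set)"
    using finite_distinct_list[of "UNIV :: 'n set"] by auto
  define P' where "P' t = restrict_fun a UNIV (\<lambda>_. undefined) (P t)" for t
  have P': "P' t d = P t a + (\<Sum>i\<in>UNIV. l t i * real (d i))" for t d
    unfolding P'_def restrict_fun_affine[OF P_eq] by (simp add: P_eq Compl_UNIV_eq)
  have P'P: "P' t d = P t d + P t a" for t d by (simp add: P' P_eq)
  have Pa: "P t a \<ge> 0" for t unfolding P_eq by (intro sum_nonneg mult_nonneg_nonneg l_nonneg) simp
  have pos: "0 < P t m" if "\<forall>i\<in>set ns. 1 \<le> m i" for t m
    using False that ns(2) by (intro P_pos) auto
  have nz': "P' t \<noteq> (\<lambda>_. 0)" for t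
    using pos[of "\<lambda>_. 1" t] Pa[of t] P'P[of t "\<lambda>_. 1"] by auto
  \<comment> \<open>Positivity matters for exponent zero, where \<open>0 powr 0\<close> is 0 but
    \<open>0 ^ 0\<close> is 1.\<close>
  have pw: "(\<Prod>t\<in>UNIV. of_real (R t) powr (- (neg_nat_vec u $ t))) = (of_real (\<Prod>t\<in>UNIV. R t ^ u t) :: complex)"
    if "\<And>t. R t > 0" for R :: "'t \<Rightarrow> real" and u
  proof -
    have "of_real (R t) powr (- (neg_nat_vec u $ t)) = (of_real (R t) :: complex) ^ u t" for t
      using that[of t] by (simp add: neg_nat_vec_def powr_nat)
    then show ?thesis by simp
  qed
  let ?c = "\<lambda>u. of_real (\<Prod>t\<in>UNIV. P t a ^ (k t - u t)) * of_nat (\<Prod>t\<in>UNIV. k t choose u t) :: complex"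
  let ?U = "{u. \<forall>t. u t \<le> k t}"
  let ?g = "\<lambda>u m. \<Prod>t\<in>UNIV. of_real (P t m) powr (- (neg_nat_vec u $ t)) :: complex"
  have finU: "finite ?U"
  proof -
    have "?U = (\<Pi>\<^sub>E t\<in>UNIV. {..k t})" by (auto simp: PiE_iff)
    then show ?thesis by (simp add: finite_PiE)
  qed
  have Z: "reg_sum ns \<mu> (?g u) (zeta UNIV (\<lambda>_. 1) P \<mu> (neg_nat_vec u))" for u
  proof (rule is_continuation_zeta(2)[OF norm_\<mu> \<mu>_neq_1 _ order.refl l_nonneg l_dep _ ns])
    show "P t d = 0 + (\<Sum>i\<in>UNIV. l t i * real (d i))" for t d by (simp only: P_eq add_0)
    show "P t \<noteq> (\<lambda>_. 0)" for t using False by blast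
  qed
  have 1: "reg_sum ns \<mu> (\<lambda>m. \<Sum>u\<in>?U. ?c u * ?g u m) (\<Sum>u\<in>?U. ?c u * zeta UNIV (\<lambda>_. 1) P \<mu> (neg_nat_vec u))"
    by (intro reg_sum_sum[OF ns(1) finU] reg_sum_cmult Z)
  have 2: "reg_sum ns \<mu> (\<lambda>m. \<Prod>t\<in>UNIV. of_real (P' t m) powr (- (neg_nat_vec k $ t)))
      (zeta UNIV (\<lambda>_. 1) P' \<mu> (neg_nat_vec k))"
    by (rule is_continuation_zeta(2)[OF norm_\<mu> \<mu>_neq_1 P' Pa l_nonneg l_dep nz' ns])
  have eq: "(\<Sum>u\<in>?U. ?c u * ?g u m) = (\<Prod>t\<in>UNIV. of_real (P' t m) powr (- (neg_nat_vec k $ t)))"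
    if m: "\<forall>i\<in>set ns. 1 \<le> m i" for m
  proof -
    have "(\<Prod>t\<in>UNIV. of_real (P' t m) powr (- (neg_nat_vec k $ t)))
        = (of_real (\<Prod>t\<in>UNIV. (P t m + P t a) ^ k t) :: complex)"
      using pw[of "\<lambda>t. P' t m" k] pos[OF m] Pa by (simp add: P'P add_pos_nonneg)
    also have "\<dots> = (\<Sum>u\<in>?U. ?c u * of_real (\<Prod>t\<in>UNIV. P t m ^ u t))"
      by (simp add: prod_binomial)
    also have "\<dots> = (\<Sum>u\<in>?U. ?c u * ?g u m)" by (simp only: pw[OF pos[OF m]])
    finally show ?thesis by simp
  qed
  have "zeta UNIV (\<lambda>_. 1) P' \<mu> (neg_nat_vec k) =
      (\<Sum>u\<in>?U. ?c u * zeta UNIV (\<lambda>_. 1) P \<mu> (neg_nat_vec u))"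
    by (rule reg_sum_unique[OF ns(1) \<mu>_neq_1 2 iffD1[OF reg_sum_cong[OF eq] 1]])
  then show ?thesis by (simp only: rzeta_def P'_def[abs_def])
qed

end

text \<open>In the decomposition \<open>b i\<close> starts at 1 because summation points have
  positive coordinates, \<open>q = 0\<close> accounts for the finitely many points with
  \<open>m n \<le> a n\<close> for all \<open>n\<close>, and the weights
  \<open>\<mu> i ^ a i\<close> come from the shift by \<open>a\<close> on \<open>I\<close>.\<close>

theorem corollary1:
  fixes \<mu> :: "'n::finite \<Rightarrow> complex"
    and L :: "'t::finite \<Rightarrow> real ^ 'n \<Rightarrow> real"
    and a :: "'n \<Rightarrow> nat"
  defines "P \<equiv> \<lambda>t m. L t (real_vec m)"
  assumes "\<And>n. \<mu> n \<in> sphere 0 1 - {1}"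
    and "\<And>t. linear (L t)"
    and "\<And>t n. L t (axis n 1) \<ge> 0"
    and "\<And>n. \<exists>t. L t (axis n 1) \<noteq> 0"
  shows "(\<exists>\<delta> :: 't \<Rightarrow> real.
            (\<forall>t x. L t (x + real_vec a) - L t x = \<delta> t) \<and>
            (\<forall>k :: 't \<Rightarrow> nat.
               (1 - (\<Prod>n\<in>UNIV. \<mu> n ^ a n)) * zeta UNIV (\<lambda>_. 1) P \<mu> (neg_nat_vec k) =
               (\<Prod>n\<in>UNIV. \<mu> n ^ a n) *
                 (\<Sum>u | (\<forall>t. u t \<le> k t) \<and> u \<noteq> k.
                    of_real (\<Prod>t\<in>UNIV. \<delta> t ^ (k t - u t)) *
                    of_nat (\<Prod>t\<in>UNIV. k t choose u t) *
                    zeta UNIV (\<lambda>_. 1) P \<mu> (neg_nat_vec u)) +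
               boundary_zeta a P \<mu> (neg_nat_vec k)))
       \<and> (\<forall>s. boundary_zeta a P \<mu> s =
            (\<Sum>q = 0..CARD('n) - 1. \<Sum>I | card I = q. \<Sum>b\<in>(\<Pi>\<^sub>E i\<in>-I. {1..a i}).
               (\<Prod>i\<in>I. \<mu> i ^ a i) * (\<Prod>i\<in>-I. \<mu> i ^ b i) *
               zeta I (\<lambda>_. 1) (\<lambda>t. restrict_fun a I b (P t)) \<mu> s))
       \<and> (\<exists>(r::nat) (c :: nat \<Rightarrow> complex) (V :: nat \<Rightarrow> 'n set)
             (R :: nat \<Rightarrow> 't \<Rightarrow> ('n \<Rightarrow> nat) \<Rightarrow> real).
            (\<forall>j<r. card (V j) \<le> CARD('n) - 1 \<and> (\<forall>t. nonneg_affine_form (V j) (R j t))) \<and>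
            (\<forall>s. boundary_zeta a P \<mu> s = (\<Sum>j<r. c j * zeta (V j) (\<lambda>_. 1) (R j) \<mu> s)))"
proof (intro conjI allI)
  define l where "l t i = L t (axis i 1)" for t i
  have L_eq: "L t x = (\<Sum>i\<in>UNIV. l t i * x $ i)" for t x
  proof -
    have "L t x = L t (\<Sum>i\<in>UNIV. x $ i *\<^sub>R axis i 1)"
      using basis_expansion[of x] by (simp add: scalar_mult_eq_scaleR)
    then show ?thesis
      using assms(3)[of t] by (simp add: linear_sum linear_scale l_def mult.commute)
  qed
  interpret linear_forms \<mu> P l a
  proof
    show "norm (\<mu> n) = 1" "\<mu> n \<noteq> 1" for n using assms(2)[of n] by auto
    show "P t m = (\<Sum>i\<in>UNIV. l t i * real (m i))" for t m by (simp add: P_def L_eq real_vec_def)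
    show "0 \<le> l t i" "\<exists>t. l t i \<noteq> 0" for t i using assms(4)[of t i] assms(5)[of i] by (simp_all add: l_def)
  qed
  have Pa: "L t (x + real_vec a) - L t x = P t a" for t x
    using linear_add[OF assms(3)] by (simp add: P_def)
  show "\<exists>\<delta> :: 't \<Rightarrow> real.
            (\<forall>t x. L t (x + real_vec a) - L t x = \<delta> t) \<and>
            (\<forall>k :: 't \<Rightarrow> nat.
               (1 - (\<Prod>n\<in>UNIV. \<mu> n ^ a n)) * zeta UNIV (\<lambda>_. 1) P \<mu> (neg_nat_vec k) =
               (\<Prod>n\<in>UNIV. \<mu> n ^ a n) *
                 (\<Sum>u | (\<forall>t. u t \<le> k t) \<and> u \<noteq> k.
                    of_real (\<Prod>t\<in>UNIV. \<delta> t ^ (k t - u t)) *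
                    of_nat (\<Prod>t\<in>UNIV. k t choose u t) *
                    zeta UNIV (\<lambda>_. 1) P \<mu> (neg_nat_vec u)) +
               boundary_zeta a P \<mu> (neg_nat_vec k))"
  \<comment> \<open>By linearity the increment of \<open>L t\<close> does not depend on the base
    point and equals its value at \<open>a\<close>.\<close>
  proof (intro exI[of _ "\<lambda>t. P t a"] conjI allI Pa)
    fix k :: "'t \<Rightarrow> nat"
    let ?Z = "\<lambda>u. zeta UNIV (\<lambda>_. 1) P \<mu> (neg_nat_vec u)"
    let ?h = "\<lambda>u. of_real (\<Prod>t\<in>UNIV. P t a ^ (k t - u t)) * of_nat (\<Prod>t\<in>UNIV. k t choose u t) * ?Z u"
    have "finite {u. \<forall>t. u t \<le> k t}"
    proof -
      have "{u. \<forall>t. u t \<le> k t} = (\<Pi>\<^sub>E t\<in>UNIV. {..k t})" by (auto simp: PiE_iff)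
      then show ?thesis by (simp add: finite_PiE)
    qed
    moreover have "{u. \<forall>t. u t \<le> k t} - {k} = {u. (\<forall>t. u t \<le> k t) \<and> u \<noteq> k}" by auto
    ultimately have "(\<Sum>u | \<forall>t. u t \<le> k t. ?h u) = ?h k + (\<Sum>u | (\<forall>t. u t \<le> k t) \<and> u \<noteq> k. ?h u)"
      by (subst sum.remove[of _ k]) auto
    \<comment> \<open>The term \<open>u = k\<close> has coefficient 1; it moves to the left-hand
      side and produces the factor \<open>1 - \<mu>\<close> to the power \<open>a\<close> there, the
      power being taken of \<open>\<mu>\<close> alone.\<close>
    then have split: "rzeta UNIV (\<lambda>_. undefined) (neg_nat_vec k) =
        ?Z k + (\<Sum>u | (\<forall>t. u t \<le> k t) \<and> u \<noteq> k. ?h u)"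
      unfolding rzeta_UNIV_neg_nat by simp
    show "(1 - (\<Prod>n\<in>UNIV. \<mu> n ^ a n)) * ?Z k =
        (\<Prod>n\<in>UNIV. \<mu> n ^ a n) * (\<Sum>u | (\<forall>t. u t \<le> k t) \<and> u \<noteq> k. ?h u) +
        boundary_zeta a P \<mu> (neg_nat_vec k)"
      using zeta_eq_boundary_plus_shift[of "neg_nat_vec k"] unfolding split
      by (simp only: algebra_simps mult_1_left)
  qed
  have le: "card I \<le> CARD('n) - 1" if "I \<noteq> UNIV" for I :: "'n set"
  proof -
    have "I \<subset> UNIV" using that by blast
    then have "card I < CARD('n)" by (intro psubset_card_mono) auto
    then show ?thesis by simp
  qed
  let ?c = "\<lambda>I b. (\<Prod>i\<in>I. \<mu> i ^ a i) * (\<Prod>i\<in>-I. \<mu> i ^ b i)"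
  show "boundary_zeta a P \<mu> s =
            (\<Sum>q = 0..CARD('n) - 1. \<Sum>I | card I = q. \<Sum>b\<in>(\<Pi>\<^sub>E i\<in>-I. {1..a i}).
               ?c I b * zeta I (\<lambda>_. 1) (\<lambda>t. restrict_fun a I b (P t)) \<mu> s)" for s
  proof -
    let ?g = "\<lambda>I. \<Sum>b\<in>(\<Pi>\<^sub>E i\<in>-I. {1..a i}). ?c I b * rzeta I b s"
    have "(\<Sum>q = 0..CARD('n) - 1. \<Sum>I | I \<in> - {UNIV} \<and> card I = q. ?g I) = (\<Sum>I\<in>- {UNIV}. ?g I)"
      using le by (intro sum.group) (simp_all add: image_subset_iff)
    \<comment> \<open>A subset with at most \<open>CARD('n) - 1\<close> elements is automatically
      proper, since \<open>CARD('n)\<close> is positive.\<close>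
    moreover have "{I. I \<in> - {UNIV} \<and> card I = q} = {I :: 'n set. card I = q}"
      if "q \<in> {0..CARD('n) - 1}" for q
    proof -
      have "q < CARD('n)"
        using that zero_less_card_finite[where 'a = 'n] by (simp only: atLeastAtMost_iff) linarith
      then show ?thesis by auto
    qed
    ultimately show ?thesis unfolding boundary_zeta_eq by (simp add: rzeta_def)
  qed
  let ?X = "Sigma (- {UNIV}) (\<lambda>I. \<Pi>\<^sub>E i\<in>-I. {1..a i})"
  have finP: "finite (\<Pi>\<^sub>E i\<in>-I. {1..a i})" for I by (intro finite_PiE) auto
  then have "finite ?X" by (intro finite_SigmaI) auto
  \<comment> \<open>Numbering the finitely many pairs \<open>(I, b)\<close> turns the double sum
    into a single linear combination indexed by naturals.\<close>
  then obtain h where h: "bij_betw h {0..<card ?X} ?X" using ex_bij_betw_nat_finite by blast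
  show "\<exists>(r::nat) (c :: nat \<Rightarrow> complex) (V :: nat \<Rightarrow> 'n set)
             (R :: nat \<Rightarrow> 't \<Rightarrow> ('n \<Rightarrow> nat) \<Rightarrow> real).
            (\<forall>j<r. card (V j) \<le> CARD('n) - 1 \<and> (\<forall>t. nonneg_affine_form (V j) (R j t))) \<and>
            (\<forall>s. boundary_zeta a P \<mu> s = (\<Sum>j<r. c j * zeta (V j) (\<lambda>_. 1) (R j) \<mu> s))"
  proof (intro exI conjI allI impI)
    fix j assume "j < card ?X"
    then have "h j \<in> ?X" using bij_betwE[OF h] by auto
    then show "card (fst (h j)) \<le> CARD('n) - 1" by (intro le) auto
    fix t
    show "nonneg_affine_form (fst (h j)) (restrict_fun a (fst (h j)) (snd (h j)) (P t))"
      unfolding nonneg_affine_form_def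
    proof (intro exI conjI allI)
      show "restrict_fun a (fst (h j)) (snd (h j)) (P t) d =
          ((\<Sum>i\<in>fst (h j). l t i * real (a i)) + (\<Sum>i\<in>-fst (h j). l t i * real (snd (h j) i)))
            + (\<Sum>i\<in>fst (h j). l t i * real (d i))" for d
        by (rule restrict_fun_affine[OF P_eq])
    qed (auto intro!: add_nonneg_nonneg sum_nonneg mult_nonneg_nonneg l_nonneg)
  next
    fix s
    have "boundary_zeta a P \<mu> s = (\<Sum>x\<in>?X. ?c (fst x) (snd x) * rzeta (fst x) (snd x) s)"
      unfolding boundary_zeta_eq using finP by (subst sum.Sigma) (auto simp: case_prod_beta)
    also have "\<dots> = (\<Sum>j\<in>{0..<card ?X}. ?c (fst (h j)) (snd (h j)) * rzeta (fst (h j)) (snd (h j)) s)"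
      by (rule sum.reindex_bij_betw[OF h, symmetric])
    finally show "boundary_zeta a P \<mu> s = (\<Sum>j<card ?X. ?c (fst (h j)) (snd (h j)) *
        zeta (fst (h j)) (\<lambda>_. 1) (\<lambda>t. restrict_fun a (fst (h j)) (snd (h j)) (P t)) \<mu> s)"
      by (simp only: rzeta_def atLeast0LessThan)
  qed
qed

end
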